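(* Let $(\mathsf{Z},\mathsf{A},p,c)$ be a Markov decision process such that $\mathsf{Z}$ and $\mathsf{A}$ are compact, $c$ is a bounded continuous real function on $\mathsf{Z}\times\mathsf{A}$, the stochastic kernel $p(\,\cdot\,|z,a)$ is continuous in $(z,a)$ with respect to the total variation distance, and there exist a non-trivial finite measure $\zeta$ on $\mathsf{Z}$, a nonnegative measurable function $\theta$ on $\mathsf{Z}\times\mathsf{A}$ and a constant $\lambda\in(0,1)$ such that for all $(z,a)\in\mathsf{Z}\times\mathsf{A}$: $p(B|z,a)\ge\zeta(B)\theta(z,a)$ for all Borel $B\subset\mathsf{Z}$, and $\frac{1-\lambda}{\zeta(\mathsf{Z})}\le\theta(z,a)$. For each $n\ge1$ let MDP$_n$ be the finite-state model described in the context, let $f_n^*:\mathsf{Z}_n\to\mathsf{A}$ be an optimal deterministic stationary policy of MDP$_n$ for the average cost, and let $\tilde f_n^*=f_n^*\circ Q_n:\mathsf{Z}\to\mathsf{A}$ be its extension to $\mathsf{Z}$. Then $$\lim_{n\to\infty}|\rho_{\tilde f_n^*}-\rho_{f^*}|=0,$$ where $\rho_f$ is the average cost of the deterministic stationary policy $f$ in the original MDP and $\rho_{f^*}$ is the average-cost value function (a constant) of the original MDP.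
   Context: A Markov decision process (MDP) $(\mathsf{Z},\mathsf{A},p,c)$ consists of Borel spaces $\mathsf{Z}$ (states) and $\mathsf{A}$ (actions, all admissible in every state), a stochastic kernel $p(dy|z,a)$ on $\mathsf{Z}$ given $\mathsf{Z}\times\mathsf{A}$, and a measurable one-stage cost $c:\mathsf{Z}\times\mathsf{A}\to\mathbb{R}$. A policy $\pi=\{\pi_t\}$ is a sequence of stochastic kernels on $\mathsf{A}$ given the histories $(z_0,a_0,\dots,z_{t-1},a_{t-1},z_t)$; $\Pi$ is the set of all policies. A deterministic stationary policy is a measurable function $f$ from states to actions, applied as $a_t=f(z_t)$. The average cost is $V(\pi,z)=\limsup_{T\to\infty}\frac1T\mathbb{E}_z^\pi[\sum_{t=0}^{T-1}c(z_t,a_t)]$ and $V^*(z)=\inf_{\pi\in\Pi}V(\pi,z)$. A policy is optimal if its cost equals the value function at every initial state. Under the hypotheses, every deterministic stationary $f$ induces a chain with kernel $p(\cdot|z,f(z))$ having a unique invariant probability measure $\mu_f$, one has $V(f,z)=\rho_f:=\int c(z,f(z))\mu_f(dz)$ for all $z$, and there is an optimal deterministic stationary policy $f^*$, so that $V^*(z)=\rho_{f^*}$ for all $z$; the same is true for MDP$_n$. Total variation: $\|\mu-\nu\|_{TV}=2\sup_D|\mu(D)-\nu(D)|=\sup_{\|g\|\le1}|\int g\,d\mu-\int g\,d\nu|$. Finite-state models: let $d_{\mathsf{Z}}$ be the metric on $\mathsf{Z}$. For each $n\ge1$ fix a finite set $\mathsf{Z}_n=\{z_{n,1},\dots,z_{n,k_n}\}\subset\mathsf{Z}$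 with $\min_i d_{\mathsf{Z}}(z,z_{n,i})<1/n$ for all $z\in\mathsf{Z}$, and $Q_n:\mathsf{Z}\to\mathsf{Z}_n$, $Q_n(z)=\arg\min_{z_{n,i}}d_{\mathsf{Z}}(z,z_{n,i})$, with ties broken so that $Q_n$ is measurable. Let $\mathcal{S}_{n,i}=\{z:Q_n(z)=z_{n,i}\}$. Let $\nu_n$ be any probability measure on $\mathsf{Z}$ with $\nu_n(\mathcal{S}_{n,i})>0$ for all $i$, and let $\nu_{n,i}$ be the probability measure on $\mathcal{S}_{n,i}$ given by $\nu_{n,i}(\cdot)=\nu_n(\cdot)/\nu_n(\mathcal{S}_{n,i})$. MDP$_n$ has state space $\mathsf{Z}_n$, action space $\mathsf{A}$, one-stage cost $c_n(z_{n,i},a)=\int_{\mathcal{S}_{n,i}}c(z,a)\,\nu_{n,i}(dz)$ and transition probability $p_n(z_{n,j}|z_{n,i},a)=\int_{\mathcal{S}_{n,i}}p(\mathcal{S}_{n,j}|z,a)\,\nu_{n,i}(dz)$. *)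

theory Defs
  imports "HOL-Probability.Probability"
begin

section \<open>Markov decision processes with the average cost criterion\<close>

text \<open>State and action spaces are given as measure spaces of which only the carrier and the
  sigma-algebra matter: \<^term>\<open>borel\<close> for a topological state space, \<^term>\<open>count_space Z\<close> for
  a finite one.\<close>

record ('s, 'a) mdp =
  states :: "'s measure"
  actions :: "'a measure"
  trans_kernel :: "'s \<times> 'a \<Rightarrow> 's measure"
  stage_cost :: "'s \<times> 'a \<Rightarrow> real"

definition is_mdp :: "('s, 'a) mdp \<Rightarrow> bool" where
  "is_mdp M \<longleftrightarrow>
     trans_kernel M \<in> states M \<Otimes>\<^sub>M actions M \<rightarrow>\<^sub>M prob_algebra (states M) \<and>
     stage_cost M \<in> borel_measurable (states M \<Otimes>\<^sub>M actions M)"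

text \<open>A history \<open>(z\<^sub>0, a\<^sub>0, \<dots>, z\<^bsub>t-1\<^esub>, a\<^bsub>t-1\<^esub>, z\<^sub>t)\<close> is encoded as a pair: the family of the
  completed steps \<open>(z\<^sub>i, a\<^sub>i)\<close>, \<open>i < t\<close>, and the current state \<open>z\<^sub>t\<close>.\<close>

definition steps :: "('s, 'a) mdp \<Rightarrow> nat \<Rightarrow> (nat \<Rightarrow> 's \<times> 'a) measure" where
  "steps M t = (\<Pi>\<^sub>M i\<in>{0..<t}. states M \<Otimes>\<^sub>M actions M)"

definition histories :: "('s, 'a) mdp \<Rightarrow> nat \<Rightarrow> ((nat \<Rightarrow> 's \<times> 'a) \<times> 's) measure" where
  "histories M t = steps M t \<Otimes>\<^sub>M states M"

type_synonym ('s, 'a) policy = "nat \<Rightarrow> (nat \<Rightarrow> 's \<times> 'a) \<times> 's \<Rightarrow> 'a measure"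

definition policies :: "('s, 'a) mdp \<Rightarrow> ('s, 'a) policy set" where
  "policies M = {\<pi>. \<forall>t. \<pi> t \<in> histories M t \<rightarrow>\<^sub>M prob_algebra (actions M)}"

definition stationary_policy :: "('s, 'a) mdp \<Rightarrow> ('s \<Rightarrow> 'a) \<Rightarrow> ('s, 'a) policy" where
  "stationary_policy M f t h = return (actions M) (f (snd h))"

text \<open>The conditional law of \<open>(z\<^sub>t, a\<^sub>t)\<close> given the completed steps, for the initial state \<open>z\<close>.\<close>

definition step_law ::
    "('s, 'a) mdp \<Rightarrow> ('s, 'a) policy \<Rightarrow> 's \<Rightarrow> nat \<Rightarrow> (nat \<Rightarrow> 's \<times> 'a) \<Rightarrow> ('s \<times> 'a) measure" where
  "step_law M \<pi> z t h =
     (if t = 0 then return (states M) z else trans_kernel M (h (t - 1))) \<bind>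
     (\<lambda>x. distr (\<pi> t (h, x)) (states M \<Otimes>\<^sub>M actions M) (\<lambda>a. (x, a)))"

text \<open>The strategic measure, i.e. the law of \<open>(z\<^sub>t, a\<^sub>t)\<^sub>t\<close>, by the Ionescu-Tulcea theorem.\<close>

definition strategic_measure ::
    "('s, 'a) mdp \<Rightarrow> ('s, 'a) policy \<Rightarrow> 's \<Rightarrow> (nat \<Rightarrow> 's \<times> 'a) measure" where
  "strategic_measure M \<pi> z =
     projective_family.lim UNIV
       (Ionescu_Tulcea.CI (step_law M \<pi> z) (\<lambda>_. states M \<Otimes>\<^sub>M actions M))
       (\<lambda>_. states M \<Otimes>\<^sub>M actions M)"

definition average_cost :: "('s, 'a) mdp \<Rightarrow> ('s, 'a) policy \<Rightarrow> 's \<Rightarrow> ereal" where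
  "average_cost M \<pi> z =
     limsup (\<lambda>T. ereal (1 / real T *
       (\<integral>\<omega>. (\<Sum>t<T. stage_cost M (\<omega> t)) \<partial>strategic_measure M \<pi> z)))"

definition average_value :: "('s, 'a) mdp \<Rightarrow> 's \<Rightarrow> ereal" where
  "average_value M z = (INF \<pi>\<in>policies M. average_cost M \<pi> z)"

definition optimal_stationary :: "('s, 'a) mdp \<Rightarrow> ('s \<Rightarrow> 'a) \<Rightarrow> bool" where
  "optimal_stationary M f \<longleftrightarrow>
     f \<in> states M \<rightarrow>\<^sub>M actions M \<and>
     (\<forall>z\<in>space (states M). average_cost M (stationary_policy M f) z = average_value M z)"

definition invariant_measure :: "('s, 'a) mdp \<Rightarrow> ('s \<Rightarrow> 'a) \<Rightarrow> 's measure \<Rightarrow> bool" where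
  "invariant_measure M f \<mu> \<longleftrightarrow>
     \<mu> \<in> space (prob_algebra (states M)) \<and> \<mu> \<bind> (\<lambda>z. trans_kernel M (z, f z)) = \<mu>"

text \<open>The constant \<open>\<rho>\<^sub>f\<close>; meaningful if the invariant probability measure of \<open>f\<close> is unique.\<close>

definition stationary_cost :: "('s, 'a) mdp \<Rightarrow> ('s \<Rightarrow> 'a) \<Rightarrow> real" where
  "stationary_cost M f =
     (\<integral>z. stage_cost M (z, f z) \<partial>(THE \<mu>. invariant_measure M f \<mu>))"


section \<open>Total variation distance\<close>

text \<open>Normalised to range over \<open>[0, 2]\<close>; for probability measures on the same sigma-algebra.\<close>

definition tv_dist :: "'s measure \<Rightarrow> 's measure \<Rightarrow> real" where
  "tv_dist \<mu> \<nu> = 2 * (SUP D\<in>sets \<mu>. \<bar>measure \<mu> D - measure \<nu> D\<bar>)"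


section \<open>Finite-state models\<close>

definition nearest_quantizer :: "nat \<Rightarrow> ('z::metric_space) set \<Rightarrow> ('z \<Rightarrow> 'z) \<Rightarrow> bool" where
  "nearest_quantizer n Z Q \<longleftrightarrow>
     finite Z \<and> Z \<noteq> {} \<and>
     (\<forall>z. (MIN w\<in>Z. dist z w) < 1 / real n) \<and>
     (\<forall>z. is_arg_min (\<lambda>w. dist z w) (\<lambda>w. w \<in> Z) (Q z)) \<and>
     Q \<in> borel \<rightarrow>\<^sub>M count_space Z"

definition cell :: "('z \<Rightarrow> 'z) \<Rightarrow> 'z \<Rightarrow> 'z set" where
  "cell Q w = {z. Q z = w}"

text \<open>The normalised restriction of \<open>\<nu>\<close> to a cell, as a measure on the whole space.\<close>

definition cell_measure :: "'z measure \<Rightarrow> ('z \<Rightarrow> 'z) \<Rightarrow> 'z \<Rightarrow> 'z measure" where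
  "cell_measure \<nu> Q w = uniform_measure \<nu> (cell Q w)"

definition finite_model ::
    "('z, 'a) mdp \<Rightarrow> 'z set \<Rightarrow> ('z \<Rightarrow> 'z) \<Rightarrow> 'z measure \<Rightarrow> ('z, 'a) mdp" where
  "finite_model M Z Q \<nu> =
     \<lparr>states = count_space Z,
      actions = actions M,
      trans_kernel = (\<lambda>(w, a). point_measure Z
        (\<lambda>w'. ennreal (\<integral>z. measure (trans_kernel M (z, a)) (cell Q w') \<partial>cell_measure \<nu> Q w))),
      stage_cost = (\<lambda>(w, a). \<integral>z. stage_cost M (z, a) \<partial>cell_measure \<nu> Q w)\<rparr>"

end

theory Submission
  imports Defs
begin

text \<open>By the minorization, \<open>p(\<cdot>|z,a) = (1 - lam) \<zeta>' + lam q(\<cdot>|z,a)\<close> for the normalised minorant \<open>\<zeta>'\<close>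
  and a stochastic kernel \<open>q\<close>. Replacing \<open>p\<close> by \<open>lam q\<close> turns the optimality operator and the
  evaluation operator of a stationary policy into contractions, whose fixed points solve the average
  cost optimality equation (with a continuous \<open>h\<close>) and the Poisson equations (with \<open>g\<close> bounded by a
  constant independent of the policy). By compactness, costs and kernels are uniformly continuous, the
  latter in total variation; so both \<open>h\<close> and the solution \<open>g\<close> for \<open>f\<^sub>n \<circ> Q\<^sub>n\<close> oscillate little on the
  cells of a fine quantizer and solve the corresponding equations of \<open>MDP\<^sub>n\<close> up to a small error.
  Telescoping along trajectories, \<open>h\<close> shows that the value of \<open>MDP\<^sub>n\<close> is close to the value of the
  original model, and \<open>g\<close> that the cost of \<open>f\<^sub>n\<close> in \<open>MDP\<^sub>n\<close> is close to the cost of \<open>f\<^sub>n \<circ> Q\<^sub>n\<close>.\<close>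

section \<open>Integrals of bounded functions\<close>

text \<open>The constant of each equation comes from the minorant: if h = inf (c + lam q h), adding
  r = (1 - lam) \<integral>h d\<zeta>' to both sides restores the full kernel p. The obstacle is the
  extended policy \<open>f n \<circ> Q n\<close>: it jumps across cell boundaries and changes with
  n, so its Poisson solution g is merely measurable. Two facts replace continuity. On a cell the
  policy is constant, hence g oscillates there no more than the one-step operator with a frozen
  action. And the modulus of that operator, coming from total variation, depends on g only through a
  bound, which is K / (1 - lam) for all policies at once when K bounds the cost; so one scale serves
  all n. The equations are solved in the original model only. MDP_n enters through averages over
  cells, under which approximate equations survive, and the sign of the remaining defect becomes a
  bound on an average cost.\<close>

lemma (in prob_space) integrable_bounded:
  fixes h :: "'a \<Rightarrow> real"
  assumes "h \<in> borel_measurable M" "\<And>x. x \<in> space M \<Longrightarrow> \<bar>h x\<bar> \<le> B"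
  shows "integrable M h"
  using assms by (intro integrable_const_bound[of _ B]) auto

lemma (in prob_space) abs_integral_le_bound:
  fixes h :: "'a \<Rightarrow> real"
  assumes "h \<in> borel_measurable M" "\<And>x. x \<in> space M \<Longrightarrow> \<bar>h x\<bar> \<le> B"
  shows "\<bar>\<integral>x. h x \<partial>M\<bar> \<le> B"
proof -
  have int: "integrable M h"
    using integrable_bounded[OF assms] by auto
  have "(\<integral>x. h x \<partial>M) \<le> B" "- B \<le> (\<integral>x. h x \<partial>M)"
    by (intro integral_le_const integral_ge_const int AE_I2; use assms(2) in \<open>force simp: abs_le_iff\<close>)+
  then show ?thesis
    by (simp add: abs_le_iff)
qed

lemma integral_bind_prob_algebra:
  fixes h :: "'b \<Rightarrow> real"
  assumes A: "A \<in> space (prob_algebra N)" and K: "K \<in> N \<rightarrow>\<^sub>M prob_algebra L"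
    and h: "h \<in> borel_measurable L" "\<And>x. x \<in> space L \<Longrightarrow> \<bar>h x\<bar> \<le> B"
  shows "(\<integral>x. h x \<partial>(A \<bind> K)) = (\<integral>y. (\<integral>x. h x \<partial>K y) \<partial>A)"
proof -
  interpret A: prob_space A
    using A by (simp add: space_prob_algebra)
  have sets_A: "sets A = sets N"
    using A by (simp add: space_prob_algebra)
  have K': "K \<in> A \<rightarrow>\<^sub>M subprob_algebra L"
    using measurable_prob_algebraD[OF K] by (simp cong: measurable_cong_sets add: sets_A)
  have "(\<integral>x. h x \<partial>(A \<bind> K)) = (\<integral>x. h x \<partial>join (distr A (subprob_algebra L) K))"
    by (simp add: bind_nonempty''[OF K' A.not_empty])
  also have "\<dots> = (\<integral>M'. integral\<^sup>L M' h \<partial>distr A (subprob_algebra L) K)"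
  proof (rule integral_join[where B = B and B' = 1])
    show "AE M' in distr A (subprob_algebra L) K. emeasure M' (space M') \<le> ennreal 1"
      by (rule AE_I2) (simp add: space_subprob_algebra subprob_space.subprob_emeasure_le_1)
    show "finite_measure (distr A (subprob_algebra L) K)"
      by (intro A.finite_measure_distr K')
  qed (use h in \<open>auto\<close>)
  also have "\<dots> = (\<integral>y. (\<integral>x. h x \<partial>K y) \<partial>A)"
    by (intro integral_distr K' integral_measurable_subprob_algebra h)
  finally show ?thesis .
qed

section \<open>From differences on sets to differences of integrals\<close>

lemma abs_measure_diff_le_tv_dist:
  assumes "prob_space \<mu>" "prob_space \<nu>" "D \<in> sets \<mu>"
  shows "2 * \<bar>measure \<mu> D - measure \<nu> D\<bar> \<le> tv_dist \<mu> \<nu>"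
proof -
  interpret mu: prob_space \<mu> by fact
  interpret nu: prob_space \<nu> by fact
  have "\<bar>measure \<mu> E - measure \<nu> E\<bar> \<le> 1" for E
    using mu.prob_le_1[of E] nu.prob_le_1[of E] measure_nonneg[of \<mu> E] measure_nonneg[of \<nu> E]
    by linarith
  then have "bdd_above ((\<lambda>E. \<bar>measure \<mu> E - measure \<nu> E\<bar>) ` sets \<mu>)"
    by (auto simp: bdd_above_def)
  from cSUP_upper[OF assms(3) this] show ?thesis
    by (simp add: tv_dist_def)
qed

text \<open>The sum counts the integers k with 1 \<le> k \<le> y. Used with y = N h(x), it turns a
  rounded value of h into a sum of indicators of superlevel sets.\<close>

lemma nat_floor_eq_sum_indicator:
  fixes y :: real
  assumes "0 \<le> y" "y \<le> real N"
  shows "real (nat \<lfloor>y\<rfloor>) = (\<Sum>k=1..N. if real k \<le> y then 1 else 0)"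
proof -
  have "{k \<in> {1..N}. real k \<le> y} = {1..nat \<lfloor>y\<rfloor>}"
    using assms by (auto simp: le_nat_floor) linarith+
  then show ?thesis
    by (simp add: sum.If_cases Int_def)
qed

text \<open>A \<open>[0,1]\<close>-valued function is within \<open>1/N\<close> of the average of the indicators of its
  \<open>N\<close> superlevel sets.\<close>

lemma abs_integral_diff_le_unit:
  fixes h :: "'a \<Rightarrow> real"
  assumes "prob_space \<mu>" "prob_space \<nu>" "sets \<mu> = sets \<nu>"
    and D: "\<And>D. D \<in> sets \<mu> \<Longrightarrow> \<bar>measure \<mu> D - measure \<nu> D\<bar> \<le> d"
    and h[measurable]: "h \<in> borel_measurable \<mu>" and h01: "\<And>x. x \<in> space \<mu> \<Longrightarrow> 0 \<le> h x \<and> h x \<le> 1"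
  shows "\<bar>(\<integral>x. h x \<partial>\<mu>) - (\<integral>x. h x \<partial>\<nu>)\<bar> \<le> d"
proof -
  have space: "space \<mu> = space \<nu>" by (rule sets_eq_imp_space_eq) fact
  \<comment> \<open>Rounding h costs 1/N under each of the two measures. For the rounded function
    the integrals differ by at most \<open>d\<close>, the average of N terms that are each bounded
    by \<open>d\<close>.\<close>
  have *: "\<bar>(\<integral>x. h x \<partial>\<mu>) - (\<integral>x. h x \<partial>\<nu>)\<bar> \<le> d + 2 / real N" if N: "N > 0" for N :: nat
  proof -
    define A where "A k = {x \<in> space \<mu>. real k / real N \<le> h x}" for k
    define s where "s x = (\<Sum>k=1..N. indicator (A k) x / real N)" for x :: 'a
    have A: "A k \<in> sets \<mu>" for k by (simp add: A_def)
    have s: "\<bar>h x - s x\<bar> \<le> 1 / real N" if x: "x \<in> space \<mu>" for x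
    proof -
      have "real (nat \<lfloor>real N * h x\<rfloor>) = (\<Sum>k=1..N. if real k \<le> real N * h x then 1 else 0)"
        using h01[OF x] by (intro nat_floor_eq_sum_indicator) (auto simp: mult_left_le)
      also have "\<dots> = (\<Sum>k=1..N. indicator (A k) x)"
        using N x by (intro sum.cong) (auto simp: A_def indicator_def field_simps)
      also have "\<dots> = real N * s x"
        using N by (simp add: s_def sum_divide_distrib[symmetric])
      finally have "real (nat \<lfloor>real N * h x\<rfloor>) = real N * s x" .
      moreover have "\<bar>real N * h x - real (nat \<lfloor>real N * h x\<rfloor>)\<bar> \<le> 1"
        using h01[OF x] N by (simp add: of_nat_nat) linarith
      ultimately have "real N * \<bar>h x - s x\<bar> \<le> 1"
        by (metis abs_mult abs_of_nat right_diff_distrib)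
      then show ?thesis using N by (simp add: field_simps)
    qed
    have int_s: "\<bar>(\<integral>x. h x \<partial>\<kappa>) - (\<Sum>k=1..N. measure \<kappa> (A k) / real N)\<bar> \<le> 1 / real N"
      if "prob_space \<kappa>" and sets: "sets \<kappa> = sets \<mu>" for \<kappa>
    proof -
      interpret prob_space \<kappa> by fact
      have [measurable]: "A k \<in> sets \<kappa>" for k using A sets by simp
      have [measurable]: "h \<in> borel_measurable \<kappa>" using h sets by (simp cong: measurable_cong_sets)
      have sp: "space \<kappa> = space \<mu>" using sets by (rule sets_eq_imp_space_eq)
      have "integrable \<kappa> h"
        using h01 by (intro integrable_bounded[of h 1]) (auto simp: sp)
      moreover have [simp]: "integrable \<kappa> (indicat_real (A k))" for k
        by (intro integrable_bounded[of _ 1]) auto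
      then have "integrable \<kappa> s"
        by (simp add: s_def[abs_def])
      moreover have "(\<integral>x. s x \<partial>\<kappa>) = (\<Sum>k=1..N. measure \<kappa> (A k) / real N)"
        unfolding s_def by (subst Bochner_Integration.integral_sum) auto
      ultimately have "(\<integral>x. h x \<partial>\<kappa>) - (\<Sum>k=1..N. measure \<kappa> (A k) / real N) = (\<integral>x. h x - s x \<partial>\<kappa>)"
        by simp
      also have "\<bar>\<dots>\<bar> \<le> 1 / real N"
        by (rule abs_integral_le_bound) (use s in \<open>auto simp: sp s_def[abs_def]\<close>)
      finally show ?thesis .
    qed
    have "\<bar>(\<Sum>k=1..N. measure \<mu> (A k) / real N) - (\<Sum>k=1..N. measure \<nu> (A k) / real N)\<bar>
        = \<bar>\<Sum>k=1..N. (measure \<mu> (A k) - measure \<nu> (A k)) / real N\<bar>"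
      by (simp add: sum_subtractf diff_divide_distrib)
    also have "\<dots> \<le> (\<Sum>k=1..N. d / real N)"
      by (intro order.trans[OF sum_abs] sum_mono) (simp add: divide_right_mono D A)
    also have "\<dots> = d" using N by simp
    finally show ?thesis
      using int_s[of \<mu>] int_s[of \<nu>] assms(1-3) by auto
  qed
  show ?thesis
  proof (rule field_le_epsilon)
    fix e :: real assume "0 < e"
    obtain n where "2 / e < real n" using reals_Archimedean2 by blast
    moreover from this \<open>0 < e\<close> have "n > 0"
      by (intro gr0I) (auto simp: field_simps)
    ultimately have "n > 0" "2 / real n < e"
      using \<open>0 < e\<close> by (simp_all add: field_simps)
    with *[of n] show "\<bar>(\<integral>x. h x \<partial>\<mu>) - (\<integral>x. h x \<partial>\<nu>)\<bar> \<le> d + e" by linarith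
  qed
qed

text \<open>The affine map (h + B) / (2 B) carries [-B, B] onto [0, 1], whence the factor 2 B. As
  \<open>d\<close> bounds differences on sets, it corresponds to half of
  \<open>tv_dist\<close>.\<close>

lemma abs_integral_diff_le:
  fixes h :: "'a \<Rightarrow> real"
  assumes "prob_space \<mu>" "prob_space \<nu>" "sets \<mu> = sets \<nu>"
    and D: "\<And>D. D \<in> sets \<mu> \<Longrightarrow> \<bar>measure \<mu> D - measure \<nu> D\<bar> \<le> d"
    and h[measurable]: "h \<in> borel_measurable \<mu>" and hB: "\<And>x. x \<in> space \<mu> \<Longrightarrow> \<bar>h x\<bar> \<le> B"
    and B: "0 < B"
  shows "\<bar>(\<integral>x. h x \<partial>\<mu>) - (\<integral>x. h x \<partial>\<nu>)\<bar> \<le> 2 * B * d"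
proof -
  interpret mu: prob_space \<mu> by fact
  interpret nu: prob_space \<nu> by fact
  have space: "space \<mu> = space \<nu>" by (rule sets_eq_imp_space_eq) fact
  have h'[measurable]: "h \<in> borel_measurable \<nu>" using h assms(3) by (simp cong: measurable_cong_sets)
  have "integrable \<mu> h"
    using hB by (intro mu.integrable_bounded[of h B]) auto
  moreover have "integrable \<nu> h"
    using hB by (intro nu.integrable_bounded[of h B]) (auto simp: space)
  ultimately have "(\<integral>x. (h x + B) / (2 * B) \<partial>\<mu>) - (\<integral>x. (h x + B) / (2 * B) \<partial>\<nu>)
      = ((\<integral>x. h x \<partial>\<mu>) - (\<integral>x. h x \<partial>\<nu>)) / (2 * B)"
    by (simp add: diff_divide_distrib add_divide_distrib mu.prob_space nu.prob_space)
  moreover have "\<bar>(\<integral>x. (h x + B) / (2 * B) \<partial>\<mu>) - (\<integral>x. (h x + B) / (2 * B) \<partial>\<nu>)\<bar> \<le> d"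
  proof (rule abs_integral_diff_le_unit[OF assms(1-3) D])
    show "0 \<le> (h x + B) / (2 * B) \<and> (h x + B) / (2 * B) \<le> 1" if "x \<in> space \<mu>" for x
      using hB[OF that] B by (auto simp: abs_le_iff)
  qed auto
  ultimately show ?thesis
    using B by (simp add: abs_mult field_simps)
qed

section \<open>Expected costs under a policy\<close>

lemma stationary_policy_in_policies:
  assumes f: "f \<in> states M \<rightarrow>\<^sub>M actions M"
  shows "stationary_policy M f \<in> policies M"
proof -
  have "(\<lambda>h. return (actions M) (f (snd h))) \<in> histories M t \<rightarrow>\<^sub>M prob_algebra (actions M)" for t
    unfolding histories_def
    by (rule measurable_compose[OF measurable_compose[OF measurable_snd f] measurable_return_prob_space])
  then show ?thesis
    by (simp add: policies_def stationary_policy_def[abs_def])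
qed

section \<open>Trajectories under an arbitrary policy and their conditional laws\<close>

locale controlled_process =
  fixes M :: "('s, 'a) mdp" and \<pi> :: "('s, 'a) policy" and z :: 's
  assumes is_mdp: "is_mdp M" and policy: "\<pi> \<in> policies M" and initial: "z \<in> space (states M)"
begin

abbreviation S where "S \<equiv> states M \<Otimes>\<^sub>M actions M"

lemma kernel_measurable[measurable]: "trans_kernel M \<in> S \<rightarrow>\<^sub>M prob_algebra (states M)"
  and cost_measurable[measurable]: "stage_cost M \<in> borel_measurable S"
  using is_mdp by (auto simp: is_mdp_def)

lemma policy_measurable[measurable]: "\<pi> t \<in> steps M t \<Otimes>\<^sub>M states M \<rightarrow>\<^sub>M prob_algebra (actions M)"
  using policy by (simp add: policies_def histories_def)

text \<open>The state marginal of \<open>step_law\<close>, split off so that state and action can be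
  integrated in turn.\<close>

definition next_law :: "nat \<Rightarrow> (nat \<Rightarrow> 's \<times> 'a) \<Rightarrow> 's measure" where
  "next_law t h = (if t = 0 then return (states M) z else trans_kernel M (h (t - 1)))"

lemma next_law_measurable: "next_law t \<in> steps M t \<rightarrow>\<^sub>M prob_algebra (states M)"
proof (cases t)
  case 0
  have "return (states M) z \<in> space (prob_algebra (states M))"
    using initial by (simp add: space_prob_algebra prob_space_return)
  then show ?thesis
    using 0 by (simp add: next_law_def[abs_def])
next
  case (Suc n)
  have "(\<lambda>h. h n) \<in> steps M t \<rightarrow>\<^sub>M S"
    unfolding steps_def using Suc by (intro measurable_component_singleton) simp
  from measurable_compose[OF this kernel_measurable] show ?thesis
    using Suc by (simp add: next_law_def[abs_def])
qed

lemma action_law_measurable: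
  "(\<lambda>(h, x). distr (\<pi> t (h, x)) S (\<lambda>a. (x, a))) \<in> steps M t \<Otimes>\<^sub>M states M \<rightarrow>\<^sub>M prob_algebra S"
  by measurable

lemma action_law_measurable2:
  assumes "h \<in> space (steps M t)"
  shows "(\<lambda>x. distr (\<pi> t (h, x)) S (\<lambda>a. (x, a))) \<in> states M \<rightarrow>\<^sub>M prob_algebra S"
  using measurable_compose[OF measurable_Pair1'[OF assms] action_law_measurable[of t]] by simp

lemma step_law_measurable: "step_law M \<pi> z t \<in> steps M t \<rightarrow>\<^sub>M prob_algebra S"
  unfolding step_law_def[abs_def] next_law_def[symmetric]
  by (rule measurable_bind_prob_space2[OF next_law_measurable action_law_measurable])

lemma integral_step_law:
  fixes \<phi> :: "'s \<times> 'a \<Rightarrow> real"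
  assumes h: "h \<in> space (steps M t)" and [measurable]: "\<phi> \<in> borel_measurable S"
    and B: "\<And>x. x \<in> space S \<Longrightarrow> \<bar>\<phi> x\<bar> \<le> B"
  shows "(\<integral>x. \<phi> x \<partial>step_law M \<pi> z t h) = (\<integral>x. (\<integral>a. \<phi> (x, a) \<partial>\<pi> t (h, x)) \<partial>next_law t h)"
proof -
  have nl: "next_law t h \<in> space (prob_algebra (states M))"
    by (rule measurable_space[OF next_law_measurable h])
  then have space_nl: "space (next_law t h) = space (states M)"
    by (auto simp: space_prob_algebra dest: sets_eq_imp_space_eq)
  have "(\<integral>x. \<phi> x \<partial>step_law M \<pi> z t h) =
      (\<integral>x. (\<integral>y. \<phi> y \<partial>distr (\<pi> t (h, x)) S (\<lambda>a. (x, a))) \<partial>next_law t h)"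
    unfolding step_law_def next_law_def[symmetric]
    by (rule integral_bind_prob_algebra[OF nl action_law_measurable2[OF h] assms(2) B])
  also have "\<dots> = (\<integral>x. (\<integral>a. \<phi> (x, a) \<partial>\<pi> t (h, x)) \<partial>next_law t h)"
  proof (intro Bochner_Integration.integral_cong refl)
    fix x assume "x \<in> space (next_law t h)"
    then have x: "x \<in> space (states M)" by (simp add: space_nl)
    have "\<pi> t (h, x) \<in> space (prob_algebra (actions M))"
      using measurable_space[OF policy_measurable] h x by (simp add: space_pair_measure)
    then have "sets (\<pi> t (h, x)) = sets (actions M)"
      by (simp add: space_prob_algebra)
    then have "(\<lambda>a. (x, a)) \<in> \<pi> t (h, x) \<rightarrow>\<^sub>M S"
      using measurable_Pair1'[OF x] by (simp cong: measurable_cong_sets)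
    then show "(\<integral>y. \<phi> y \<partial>distr (\<pi> t (h, x)) S (\<lambda>a. (x, a))) = (\<integral>a. \<phi> (x, a) \<partial>\<pi> t (h, x))"
      by (intro integral_distr) auto
  qed
  finally show ?thesis .
qed

sublocale IT: Ionescu_Tulcea "step_law M \<pi> z" "\<lambda>_. S"
proof (rule Ionescu_Tulcea.intro)
  show "step_law M \<pi> z i \<in> PiM {0..<i} (\<lambda>_. S) \<rightarrow>\<^sub>M subprob_algebra S" for i
    using step_law_measurable[of i] by (simp add: steps_def measurable_prob_algebraD)
  show "prob_space (step_law M \<pi> z i x)" if "x \<in> space (PiM {0..<i} (\<lambda>_. S))" for i x
    using measurable_space[OF step_law_measurable] that by (simp add: steps_def space_prob_algebra)
qed

abbreviation P where "P \<equiv> strategic_measure M \<pi> z"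

text \<open>The constantly \<open>undefined\<close> function is the only point of the empty product,
  so this is the law of the first t pairs started from the empty history.\<close>

definition history_law :: "nat \<Rightarrow> (nat \<Rightarrow> 's \<times> 'a) measure" where
  "history_law t = IT.C 0 t (\<lambda>_. undefined)"

lemma sets_P: "sets P = sets (PiM UNIV (\<lambda>_. S))"
  by (simp add: strategic_measure_def)

text \<open>The total mass is read off the marginal on the empty index set, which the projective
  limit prescribes.\<close>

lemma prob_space_P: "prob_space P"
proof (rule prob_space_distrD)
  show "(\<lambda>\<omega>. restrict \<omega> {}) \<in> P \<rightarrow>\<^sub>M PiM {} (\<lambda>_. S)"
    by (intro measurable_restrict) simp
  show "prob_space (distr P (PiM {} (\<lambda>_. S)) (\<lambda>\<omega>. restrict \<omega> {}))"
    unfolding strategic_measure_def using IT.distr_lim[of "{}"] IT.PF.prob_space_P[of "{}"] by simp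
qed

lemma history_law_in_prob_algebra: "history_law t \<in> space (prob_algebra (steps M t))"
  using IT.prob_space_C[of "\<lambda>_. undefined" 0 t] IT.sets_C[of "\<lambda>_. undefined" 0 t]
  by (simp add: history_law_def space_prob_algebra steps_def)

lemma distr_P_restrict: "distr P (steps M t) (\<lambda>\<omega>. restrict \<omega> {0..<t}) = history_law t"
proof -
  \<comment> \<open>\<open>IT.CI\<close> projects the law of the first \<open>IT.up_to J\<close>
    pairs to the coordinates in J; for an initial segment the projection discards nothing.\<close>
  have "IT.up_to {0..<t} = t"
  proof (rule antisym)
    show "t \<le> IT.up_to {0..<t}"
      using IT.up_to_less[of "{0..<t}" "t - 1"] by (cases t) auto
  qed (simp add: IT.up_to_iff_Ico)
  then show ?thesis
    unfolding strategic_measure_def steps_def history_law_def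
    using IT.distr_lim[of "{0..<t}"] IT.distr_C[of t t "\<lambda>_. undefined" 0]
    by (simp add: IT.CI_def)
qed

lemma component_measurable[measurable]: "(\<lambda>\<omega>. \<omega> t) \<in> P \<rightarrow>\<^sub>M S"
  by (simp cong: measurable_cong_sets add: sets_P)

text \<open>Coordinate t is visible only among the first t + 1 pairs. Their law is
  \<open>history_law t\<close> extended by \<open>IT.eP t\<close>, which appends a draw from
  \<open>step_law\<close> to the history.\<close>

lemma integral_component:
  fixes \<phi> :: "'s \<times> 'a \<Rightarrow> real"
  assumes [measurable]: "\<phi> \<in> borel_measurable S" and B: "\<And>x. x \<in> space S \<Longrightarrow> \<bar>\<phi> x\<bar> \<le> B"
  shows "(\<integral>\<omega>. \<phi> (\<omega> t) \<partial>P) = (\<integral>h. (\<integral>x. \<phi> x \<partial>step_law M \<pi> z t h) \<partial>history_law t)"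
proof -
  have comp: "(\<lambda>h. h t) \<in> steps M (Suc t) \<rightarrow>\<^sub>M S"
    unfolding steps_def by (rule measurable_component_singleton) simp
  have eP: "IT.eP t \<in> steps M t \<rightarrow>\<^sub>M prob_algebra (steps M (Suc t))"
    unfolding steps_def by (rule measurable_prob_algebraI[OF IT.prob_space_eP IT.measurable_eP])
  have "(\<integral>\<omega>. \<phi> (\<omega> t) \<partial>P) = (\<integral>\<omega>. \<phi> (restrict \<omega> {0..<Suc t} t) \<partial>P)"
    by simp
  also have "\<dots> = (\<integral>h. \<phi> (h t) \<partial>distr P (steps M (Suc t)) (\<lambda>\<omega>. restrict \<omega> {0..<Suc t}))"
  proof (rule integral_distr[symmetric])
    show "(\<lambda>\<omega>. restrict \<omega> {0..<Suc t}) \<in> P \<rightarrow>\<^sub>M steps M (Suc t)"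
      unfolding steps_def by (intro measurable_restrict component_measurable)
  qed (rule measurable_compose[OF comp assms(1)])
  also have "\<dots> = (\<integral>h. \<phi> (h t) \<partial>(history_law t \<bind> IT.eP t))"
    unfolding distr_P_restrict by (simp add: history_law_def)
  also have "\<dots> = (\<integral>h. (\<integral>h'. \<phi> (h' t) \<partial>IT.eP t h) \<partial>history_law t)"
    using B measurable_space[OF comp]
    by (intro integral_bind_prob_algebra[OF history_law_in_prob_algebra eP measurable_compose[OF comp assms(1)]])
       blast
  also have "\<dots> = (\<integral>h. (\<integral>x. \<phi> x \<partial>step_law M \<pi> z t h) \<partial>history_law t)"
  proof (intro Bochner_Integration.integral_cong refl)
    fix h assume "h \<in> space (history_law t)"
    then have h: "h \<in> space (PiM {0..<t} (\<lambda>_. S))"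
      using history_law_in_prob_algebra[of t]
      by (auto simp: space_prob_algebra steps_def dest: sets_eq_imp_space_eq)
    have "(\<lambda>x. h(t := x)) \<in> S \<rightarrow>\<^sub>M PiM {0..<Suc t} (\<lambda>_. S)"
      using h by (intro measurable_fun_upd[where J = "{0..<t}"] measurable_const) auto
    then have upd: "(\<lambda>x. h(t := x)) \<in> step_law M \<pi> z t h \<rightarrow>\<^sub>M PiM {0..<Suc t} (\<lambda>_. S)"
      by (simp cong: measurable_cong_sets add: IT.sets_P[OF h])
    have "(\<integral>h'. \<phi> (h' t) \<partial>IT.eP t h) = (\<integral>x. \<phi> ((h(t := x)) t) \<partial>step_law M \<pi> z t h)"
      unfolding IT.eP_def
      by (rule integral_distr[OF upd measurable_compose[OF comp[unfolded steps_def] assms(1)]])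
    then show "(\<integral>h'. \<phi> (h' t) \<partial>IT.eP t h) = (\<integral>x. \<phi> x \<partial>step_law M \<pi> z t h)"
      by simp
  qed
  finally show ?thesis .
qed

lemma space_history_law: "space (history_law t) = space (steps M t)"
  using history_law_in_prob_algebra[of t] by (auto simp: space_prob_algebra dest: sets_eq_imp_space_eq)

lemma fst_integral_step_law:
  fixes g :: "'s \<Rightarrow> real"
  assumes h: "h \<in> space (steps M t)" and [measurable]: "g \<in> borel_measurable (states M)"
    and B: "\<And>x. x \<in> space (states M) \<Longrightarrow> \<bar>g x\<bar> \<le> B"
  shows "(\<integral>x. g (fst x) \<partial>step_law M \<pi> z t h) = (\<integral>x. g x \<partial>next_law t h)"
proof -
  have nl: "next_law t h \<in> space (prob_algebra (states M))"
    by (rule measurable_space[OF next_law_measurable h])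
  then have space_nl: "space (next_law t h) = space (states M)"
    by (auto simp: space_prob_algebra dest: sets_eq_imp_space_eq)
  have "(\<integral>x. g (fst x) \<partial>step_law M \<pi> z t h) = (\<integral>x. (\<integral>a. g (fst (x, a)) \<partial>\<pi> t (h, x)) \<partial>next_law t h)"
    using B by (intro integral_step_law[OF h, of _ B]) (auto simp: space_pair_measure)
  also have "\<dots> = (\<integral>x. g x \<partial>next_law t h)"
  proof (intro Bochner_Integration.integral_cong refl)
    fix x assume "x \<in> space (next_law t h)"
    then have "\<pi> t (h, x) \<in> space (prob_algebra (actions M))"
      using measurable_space[OF policy_measurable] h by (simp add: space_pair_measure space_nl)
    then interpret prob_space "\<pi> t (h, x)" by (simp add: space_prob_algebra)
    show "(\<integral>a. g (fst (x, a)) \<partial>\<pi> t (h, x)) = g x"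
      by (simp add: prob_space)
  qed
  finally show ?thesis .
qed

lemma integral_fst_component_0:
  fixes g :: "'s \<Rightarrow> real"
  assumes [measurable]: "g \<in> borel_measurable (states M)"
    and B: "\<And>x. x \<in> space (states M) \<Longrightarrow> \<bar>g x\<bar> \<le> B"
  shows "(\<integral>\<omega>. g (fst (\<omega> 0)) \<partial>P) = g z"
proof -
  interpret prob_space "history_law 0"
    using history_law_in_prob_algebra[of 0] by (simp add: space_prob_algebra)
  have "(\<integral>\<omega>. g (fst (\<omega> 0)) \<partial>P) = (\<integral>h. (\<integral>x. g (fst x) \<partial>step_law M \<pi> z 0 h) \<partial>history_law 0)"
    using B by (intro integral_component[of _ B]) (auto simp: space_pair_measure)
  also have "\<dots> = (\<integral>h. g z \<partial>history_law 0)"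
    using initial fst_integral_step_law[OF _ assms]
    by (intro Bochner_Integration.integral_cong) (auto simp: space_history_law next_law_def integral_return)
  finally show ?thesis by (simp add: prob_space)
qed

lemma integral_kernel_measurable:
  fixes g :: "'s \<Rightarrow> real"
  assumes "g \<in> borel_measurable (states M)"
  shows "(\<lambda>x. \<integral>y. g y \<partial>trans_kernel M x) \<in> borel_measurable S"
  by (rule measurable_compose[OF measurable_prob_algebraD[OF kernel_measurable]
        integral_measurable_subprob_algebra[OF assms]])

lemma abs_integral_kernel_le:
  fixes g :: "'s \<Rightarrow> real"
  assumes "g \<in> borel_measurable (states M)" and B: "\<And>x. x \<in> space (states M) \<Longrightarrow> \<bar>g x\<bar> \<le> B"
    and "x \<in> space S"
  shows "\<bar>\<integral>y. g y \<partial>trans_kernel M x\<bar> \<le> B"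
proof -
  have *: "trans_kernel M x \<in> space (prob_algebra (states M))"
    by (rule measurable_space[OF kernel_measurable assms(3)])
  then interpret prob_space "trans_kernel M x" by (simp add: space_prob_algebra)
  from * have sets: "sets (trans_kernel M x) = sets (states M)" by (simp add: space_prob_algebra)
  from sets_eq_imp_space_eq[OF this] sets show ?thesis
    using assms(1) B by (intro abs_integral_le_bound) (auto cong: measurable_cong_sets)
qed

text \<open>Tower property: given the first t + 1 pairs, the next state has law
  \<open>trans_kernel M (\<omega> t)\<close> whatever the policy, which intervenes only when the
  next action is drawn.\<close>

lemma integral_fst_component_Suc:
  fixes g :: "'s \<Rightarrow> real"
  assumes g[measurable]: "g \<in> borel_measurable (states M)"
    and B: "\<And>x. x \<in> space (states M) \<Longrightarrow> \<bar>g x\<bar> \<le> B"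
  shows "(\<integral>\<omega>. g (fst (\<omega> (Suc t))) \<partial>P) = (\<integral>\<omega>. (\<integral>y. g y \<partial>trans_kernel M (\<omega> t)) \<partial>P)"
proof -
  have comp: "(\<lambda>h. h t) \<in> steps M (Suc t) \<rightarrow>\<^sub>M S"
    unfolding steps_def by (rule measurable_component_singleton) simp
  have "(\<integral>\<omega>. g (fst (\<omega> (Suc t))) \<partial>P)
      = (\<integral>h. (\<integral>x. g (fst x) \<partial>step_law M \<pi> z (Suc t) h) \<partial>history_law (Suc t))"
    using B by (intro integral_component[of _ B]) (auto simp: space_pair_measure)
  also have "\<dots> = (\<integral>h. (\<integral>y. g y \<partial>trans_kernel M (h t)) \<partial>history_law (Suc t))"
    using fst_integral_step_law[OF _ assms]
    by (intro Bochner_Integration.integral_cong) (auto simp: space_history_law next_law_def)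
  also have "\<dots> = (\<integral>\<omega>. (\<integral>y. g y \<partial>trans_kernel M (restrict \<omega> {0..<Suc t} t)) \<partial>P)"
    unfolding distr_P_restrict[symmetric]
  proof (rule integral_distr)
    show "(\<lambda>\<omega>. restrict \<omega> {0..<Suc t}) \<in> P \<rightarrow>\<^sub>M steps M (Suc t)"
      unfolding steps_def by (intro measurable_restrict component_measurable)
  qed (rule measurable_compose[OF comp integral_kernel_measurable[OF g]])
  finally show ?thesis by simp
qed

text \<open>The defect in the Poisson equation r + g = c + p g: zero for an exact solution, of one
  sign for a sub- or supersolution.\<close>

definition discrepancy :: "('s \<Rightarrow> real) \<Rightarrow> real \<Rightarrow> 's \<times> 'a \<Rightarrow> real" where
  "discrepancy g r x = stage_cost M x + (\<integral>y. g y \<partial>trans_kernel M x) - g (fst x) - r"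

section \<open>Bounds on the average cost by telescoping\<close>

context
  fixes g :: "'s \<Rightarrow> real" and K B r :: real
  assumes g[measurable]: "g \<in> borel_measurable (states M)"
    and B: "\<And>x. x \<in> space (states M) \<Longrightarrow> \<bar>g x\<bar> \<le> B"
    and K: "\<And>x. x \<in> space S \<Longrightarrow> \<bar>stage_cost M x\<bar> \<le> K"
begin

lemma discrepancy_measurable[measurable]: "discrepancy g r \<in> borel_measurable S"
  unfolding discrepancy_def[abs_def] using integral_kernel_measurable[OF g] by measurable

lemma discrepancy_bounded: "x \<in> space S \<Longrightarrow> \<bar>discrepancy g r x\<bar> \<le> K + 2 * B + \<bar>r\<bar>"
  using K[of x] B[of "fst x"] abs_integral_kernel_le[OF g B, of x]
  by (auto simp: discrepancy_def space_pair_measure)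

text \<open>Summing the one-step identity \<open>c = r + g(z\<^sub>t) - E g(z\<^bsub>t+1\<^esub>) + discrepancy\<close> along a
  trajectory telescopes.\<close>

lemma expected_total_cost:
  "(\<integral>\<omega>. (\<Sum>t<T. stage_cost M (\<omega> t)) \<partial>P) =
     real T * r + g z - (\<integral>\<omega>. g (fst (\<omega> T)) \<partial>P) +
     (\<Sum>t<T. \<integral>h. (\<integral>x. discrepancy g r x \<partial>step_law M \<pi> z t h) \<partial>history_law t)"
proof -
  interpret prob_space P by (rule prob_space_P)
  have sp: "\<omega> t \<in> space S" if "\<omega> \<in> space P" for \<omega> t
    by (rule measurable_space[OF component_measurable that])
  have int_c: "integrable P (\<lambda>\<omega>. stage_cost M (\<omega> t))" for t
    by (rule integrable_bounded[of _ K]) (auto intro: K sp)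
  have int_g: "integrable P (\<lambda>\<omega>. g (fst (\<omega> t)))" for t
    using sp[of _ t] by (intro integrable_bounded[of _ B]) (auto simp: space_pair_measure mem_Times_iff intro!: B)
  have int_k: "integrable P (\<lambda>\<omega>. \<integral>y. g y \<partial>trans_kernel M (\<omega> t))" for t
    using measurable_compose[OF component_measurable integral_kernel_measurable[OF g]]
    by (rule integrable_bounded[of _ B]) (auto intro: abs_integral_kernel_le[OF g B] sp)
  have step: "(\<integral>\<omega>. stage_cost M (\<omega> t) \<partial>P) = r + (\<integral>\<omega>. g (fst (\<omega> t)) \<partial>P) - (\<integral>\<omega>. g (fst (\<omega> (Suc t))) \<partial>P)
      + (\<integral>h. (\<integral>x. discrepancy g r x \<partial>step_law M \<pi> z t h) \<partial>history_law t)" for t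
  proof -
    have "(\<integral>h. (\<integral>x. discrepancy g r x \<partial>step_law M \<pi> z t h) \<partial>history_law t) = (\<integral>\<omega>. discrepancy g r (\<omega> t) \<partial>P)"
      by (rule integral_component[symmetric, OF discrepancy_measurable discrepancy_bounded])
    also have "\<dots> = (\<integral>\<omega>. stage_cost M (\<omega> t) \<partial>P) + (\<integral>\<omega>. g (fst (\<omega> (Suc t))) \<partial>P)
        - (\<integral>\<omega>. g (fst (\<omega> t)) \<partial>P) - r"
      using integral_fst_component_Suc[OF g B, of t] unfolding discrepancy_def
      by (simp add: int_c int_g int_k prob_space)
    finally show ?thesis by simp
  qed
  have "(\<integral>\<omega>. (\<Sum>t<T. stage_cost M (\<omega> t)) \<partial>P) = (\<Sum>t<T. \<integral>\<omega>. stage_cost M (\<omega> t) \<partial>P)"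
    by (rule Bochner_Integration.integral_sum) (rule int_c)
  also have "\<dots> = real T * r + g z - (\<integral>\<omega>. g (fst (\<omega> T)) \<partial>P) +
     (\<Sum>t<T. \<integral>h. (\<integral>x. discrepancy g r x \<partial>step_law M \<pi> z t h) \<partial>history_law t)"
    by (induction T) (simp_all add: integral_fst_component_0[OF g B] step algebra_simps)
  finally show ?thesis .
qed

lemma abs_expected_terminal_le: "\<bar>g z - (\<integral>\<omega>. g (fst (\<omega> T)) \<partial>P)\<bar> \<le> 2 * B"
proof -
  interpret prob_space P by (rule prob_space_P)
  have "\<bar>\<integral>\<omega>. g (fst (\<omega> T)) \<partial>P\<bar> \<le> B"
    using measurable_space[OF component_measurable, of _ T]
    by (intro abs_integral_le_bound) (auto intro!: B simp: space_pair_measure mem_Times_iff)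
  with B[OF initial] show ?thesis by linarith
qed

text \<open>The boundary terms of the telescoped sum stay below 2 B and vanish after division by T.
  The sign is required of the conditional mean given the history rather than pointwise, because for
  a stationary policy the inequality will be known only on the graph of f.\<close>

lemma average_cost_ge:
  assumes "\<And>t h. h \<in> space (steps M t) \<Longrightarrow> 0 \<le> (\<integral>x. discrepancy g r x \<partial>step_law M \<pi> z t h)"
  shows "ereal r \<le> average_cost M \<pi> z"
proof -
  have "(\<lambda>T. r - 2 * B / real T) \<longlonglongrightarrow> r - 0"
    by (intro tendsto_diff tendsto_const real_tendsto_divide_at_top[where c = "2 * B"] filterlim_real_sequentially)
  then have "limsup (\<lambda>T. ereal (r - 2 * B / real T)) = ereal r"
    by (intro lim_imp_Limsup) auto
  moreover have "limsup (\<lambda>T. ereal (r - 2 * B / real T)) \<le> average_cost M \<pi> z"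
    unfolding average_cost_def
  \<comment> \<open>At T = 0 both quotients are 0 by convention and the comparison would read r
    \<le> 0, hence the restriction to T > 0.\<close>
  proof (rule Limsup_mono, rule eventually_mono[OF eventually_gt_at_top[of 0]])
    fix T :: nat assume T: "0 < T"
    have "0 \<le> (\<Sum>t<T. \<integral>h. (\<integral>x. discrepancy g r x \<partial>step_law M \<pi> z t h) \<partial>history_law t)"
      by (intro sum_nonneg integral_nonneg_AE AE_I2 assms) (simp add: space_history_law)
    with abs_expected_terminal_le[of T]
    have "real T * r - 2 * B \<le> (\<integral>\<omega>. (\<Sum>t<T. stage_cost M (\<omega> t)) \<partial>P)"
      unfolding expected_total_cost[of T] by linarith
    from divide_right_mono[OF this, of "real T"]
    show "ereal (r - 2 * B / real T) \<le> ereal (1 / real T * (\<integral>\<omega>. (\<Sum>t<T. stage_cost M (\<omega> t)) \<partial>P))"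
      using T by (simp add: diff_divide_distrib)
  qed
  ultimately show ?thesis by simp
qed

lemma average_cost_le:
  assumes "\<And>t h. h \<in> space (steps M t) \<Longrightarrow> (\<integral>x. discrepancy g r x \<partial>step_law M \<pi> z t h) \<le> 0"
  shows "average_cost M \<pi> z \<le> ereal r"
proof -
  have "(\<lambda>T. r + 2 * B / real T) \<longlonglongrightarrow> r + 0"
    by (intro tendsto_add tendsto_const real_tendsto_divide_at_top[where c = "2 * B"] filterlim_real_sequentially)
  then have "limsup (\<lambda>T. ereal (r + 2 * B / real T)) = ereal r"
    by (intro lim_imp_Limsup) auto
  moreover have "average_cost M \<pi> z \<le> limsup (\<lambda>T. ereal (r + 2 * B / real T))"
    unfolding average_cost_def
  proof (rule Limsup_mono, rule eventually_mono[OF eventually_gt_at_top[of 0]])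
    fix T :: nat assume T: "0 < T"
    \<comment> \<open>Negation reduces the claim to nonnegativity of an integral, which holds for
      any nonnegative integrand: a non-integrable one has integral 0.\<close>
    have "0 \<le> (\<integral>h. - (\<integral>x. discrepancy g r x \<partial>step_law M \<pi> z t h) \<partial>history_law t)" for t
      by (intro integral_nonneg_AE AE_I2) (simp add: space_history_law assms)
    then have "(\<Sum>t<T. \<integral>h. (\<integral>x. discrepancy g r x \<partial>step_law M \<pi> z t h) \<partial>history_law t) \<le> 0"
      by (intro sum_nonpos) simp
    with abs_expected_terminal_le[of T]
    have "(\<integral>\<omega>. (\<Sum>t<T. stage_cost M (\<omega> t)) \<partial>P) \<le> real T * r + 2 * B"
      unfolding expected_total_cost[of T] by linarith
    from divide_right_mono[OF this, of "real T"]
    show "ereal (1 / real T * (\<integral>\<omega>. (\<Sum>t<T. stage_cost M (\<omega> t)) \<partial>P)) \<le> ereal (r + 2 * B / real T)"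
      using T by (simp add: add_divide_distrib)
  qed
  ultimately show ?thesis by simp
qed

end

end

text \<open>The inequality is assumed at every state-action pair, so its conditional mean keeps the
  sign however a randomized, history-dependent policy selects actions. This yields lower bounds on
  the value function.\<close>

lemma average_cost_policy_ge:
  fixes M :: "('s, 'a) mdp"
  assumes "is_mdp M" "\<pi> \<in> policies M" "z \<in> space (states M)"
    and "g \<in> borel_measurable (states M)" "\<And>x. x \<in> space (states M) \<Longrightarrow> \<bar>g x\<bar> \<le> B"
    and "\<And>x. x \<in> space (states M \<Otimes>\<^sub>M actions M) \<Longrightarrow> \<bar>stage_cost M x\<bar> \<le> K"
    and ge: "\<And>x a. x \<in> space (states M) \<Longrightarrow> a \<in> space (actions M) \<Longrightarrow>
      r \<le> stage_cost M (x, a) + (\<integral>y. g y \<partial>trans_kernel M (x, a)) - g x"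
  shows "ereal r \<le> average_cost M \<pi> z"
proof -
  interpret controlled_process M \<pi> z by standard fact+
  show ?thesis
  proof (rule average_cost_ge[OF assms(4-6)])
    fix t h assume h: "h \<in> space (steps M t)"
    have "step_law M \<pi> z t h \<in> space (prob_algebra S)"
      by (rule measurable_space[OF step_law_measurable h])
    then have "space (step_law M \<pi> z t h) = space S"
      by (auto simp: space_prob_algebra dest: sets_eq_imp_space_eq)
    then show "0 \<le> (\<integral>x. discrepancy g r x \<partial>step_law M \<pi> z t h)"
      using ge by (intro integral_nonneg_AE AE_I2) (auto simp: discrepancy_def space_pair_measure algebra_simps)
  qed
qed

section \<open>Stationary policies\<close>

context
  fixes M :: "('s, 'a) mdp" and f :: "'s \<Rightarrow> 'a" and z :: 's and g :: "'s \<Rightarrow> real" and B K r :: real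
  assumes is_mdp: "is_mdp M" and f: "f \<in> states M \<rightarrow>\<^sub>M actions M" and z: "z \<in> space (states M)"
    and g: "g \<in> borel_measurable (states M)" "\<And>x. x \<in> space (states M) \<Longrightarrow> \<bar>g x\<bar> \<le> B"
    and K: "\<And>x. x \<in> space (states M \<Otimes>\<^sub>M actions M) \<Longrightarrow> \<bar>stage_cost M x\<bar> \<le> K"
begin

interpretation controlled_process M "stationary_policy M f" z
  by standard (use is_mdp f z in \<open>auto intro: stationary_policy_in_policies\<close>)

text \<open>The action law is a point mass, so only values on the graph of f enter; the two bounds
  that follow can therefore ask for their inequality at (x, f x) alone.\<close>

lemma integral_step_law_stationary:
  assumes h: "h \<in> space (steps M t)"
  shows "(\<integral>x. discrepancy g r x \<partial>step_law M (stationary_policy M f) z t h) =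
     (\<integral>x. discrepancy g r (x, f x) \<partial>next_law t h)"
proof -
  have nl: "next_law t h \<in> space (prob_algebra (states M))"
    by (rule measurable_space[OF next_law_measurable h])
  then have space_nl: "space (next_law t h) = space (states M)"
    by (auto simp: space_prob_algebra dest: sets_eq_imp_space_eq)
  have "(\<integral>x. discrepancy g r x \<partial>step_law M (stationary_policy M f) z t h) =
      (\<integral>x. (\<integral>a. discrepancy g r (x, a) \<partial>stationary_policy M f t (h, x)) \<partial>next_law t h)"
    by (rule integral_step_law[OF h discrepancy_measurable[OF g K] discrepancy_bounded[OF g K]])
  also have "\<dots> = (\<integral>x. discrepancy g r (x, f x) \<partial>next_law t h)"
  proof (intro Bochner_Integration.integral_cong refl)
    fix x assume "x \<in> space (next_law t h)"
    then have x: "x \<in> space (states M)" by (simp add: space_nl)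
    have "(\<lambda>a. discrepancy g r (x, a)) \<in> borel_measurable (actions M)"
      by (rule measurable_compose[OF measurable_Pair1'[OF x] discrepancy_measurable[OF g K]])
    then show "(\<integral>a. discrepancy g r (x, a) \<partial>stationary_policy M f t (h, x)) = discrepancy g r (x, f x)"
      using measurable_space[OF f x] by (simp add: stationary_policy_def integral_return)
  qed
  finally show ?thesis .
qed

lemma space_next_law: "h \<in> space (steps M t) \<Longrightarrow> space (next_law t h) = space (states M)"
  using measurable_space[OF next_law_measurable, of h t]
  by (auto simp: space_prob_algebra dest: sets_eq_imp_space_eq)

lemma average_cost_stationary_ge:
  assumes "\<And>x. x \<in> space (states M) \<Longrightarrow>
      r \<le> stage_cost M (x, f x) + (\<integral>y. g y \<partial>trans_kernel M (x, f x)) - g x"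
  shows "ereal r \<le> average_cost M (stationary_policy M f) z"
proof (rule average_cost_ge[OF g K])
  fix t h assume h: "h \<in> space (steps M t)"
  have "0 \<le> (\<integral>x. discrepancy g r (x, f x) \<partial>next_law t h)"
    using assms by (intro integral_nonneg_AE AE_I2) (auto simp: space_next_law[OF h] discrepancy_def algebra_simps)
  then show "0 \<le> (\<integral>x. discrepancy g r x \<partial>step_law M (stationary_policy M f) z t h)"
    by (simp add: integral_step_law_stationary[OF h])
qed

lemma average_cost_stationary_le:
  assumes "\<And>x. x \<in> space (states M) \<Longrightarrow>
      stage_cost M (x, f x) + (\<integral>y. g y \<partial>trans_kernel M (x, f x)) - g x \<le> r"
  shows "average_cost M (stationary_policy M f) z \<le> ereal r"
proof (rule average_cost_le[OF g K])
  fix t h assume h: "h \<in> space (steps M t)"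
  have "0 \<le> (\<integral>x. - discrepancy g r (x, f x) \<partial>next_law t h)"
    using assms by (intro integral_nonneg_AE AE_I2) (auto simp: space_next_law[OF h] discrepancy_def algebra_simps)
  then show "(\<integral>x. discrepancy g r x \<partial>step_law M (stationary_policy M f) z t h) \<le> 0"
    by (simp add: integral_step_law_stationary[OF h])
qed

end

section \<open>Kernels with a common minorant\<close>

text \<open>Banach iteration from 0 in the sup distance on bounded measurable functions; the limit
  is measurable as a pointwise limit of the iterates. The contraction is stated as propagation of a
  uniform bound \<open>d\<close>, so that no supremum has to be handled.\<close>

lemma contraction_fixed_point:
  fixes T :: "('x \<Rightarrow> real) \<Rightarrow> 'x \<Rightarrow> real"
  assumes lam: "0 \<le> lam" "lam < 1"
    and T: "\<And>h. h \<in> borel_measurable N \<Longrightarrow> bounded (range h) \<Longrightarrow>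
      T h \<in> borel_measurable N \<and> bounded (range (T h))"
    and contr: "\<And>h h' d x. h \<in> borel_measurable N \<Longrightarrow> bounded (range h) \<Longrightarrow>
      h' \<in> borel_measurable N \<Longrightarrow> bounded (range h') \<Longrightarrow>
      (\<And>x. \<bar>h x - h' x\<bar> \<le> d) \<Longrightarrow> \<bar>T h x - T h' x\<bar> \<le> lam * d"
  obtains h where "h \<in> borel_measurable N" "bounded (range h)" "T h = h"
proof -
  define u where "u n = (T ^^ n) (\<lambda>_. 0)" for n
  have u_Suc: "u (Suc n) = T (u n)" for n by (simp add: u_def)
  have u: "u n \<in> borel_measurable N \<and> bounded (range (u n))" for n
  proof (induction n)
    case 0 then show ?case by (simp add: u_def image_def)
  next
    case (Suc n) then show ?case using T by (simp add: u_Suc)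
  qed
  obtain B where B: "\<bar>u 1 x\<bar> \<le> B" for x
    using u[of 1] by (auto simp: bounded_iff)
  \<comment> \<open>The tail lam^n B + lam^(n+1) B + ... of the geometric series that dominates the
    increments of the iteration.\<close>
  define E where "E n = lam ^ n * (B / (1 - lam))" for n
  have step: "\<bar>u (Suc n) x - u n x\<bar> \<le> lam ^ n * B" for n x
  proof (induction n arbitrary: x)
    case 0 then show ?case using B[of x] by (simp add: u_def)
  next
    case (Suc n)
    show ?case
      using contr[of "u (Suc n)" "u n" "lam ^ n * B" x] u[of "Suc n"] u[of n] Suc by (simp add: u_Suc mult.assoc)
  qed
  have E_step: "lam ^ n * B + E (Suc n) = E n" for n
    using lam by (simp add: E_def field_simps)
  have E0: "0 \<le> E n" for n
    using lam B[of undefined] abs_ge_zero[of "u 1 undefined"] by (simp add: E_def del: abs_ge_zero)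
  have dist_u: "\<bar>u (n + k) x - u n x\<bar> \<le> E n - E (n + k)" for n k x
  proof (induction k)
    case (Suc k)
    then show ?case using step[of "n + k" x] E_step[of "n + k"] by simp
  qed simp
  have dist_u': "\<bar>u (n + k) x - u n x\<bar> \<le> E n" for n k x
    using dist_u[of n k x] E0[of "n + k"] by linarith
  have E_lim: "E \<longlonglongrightarrow> 0"
    unfolding E_def[abs_def] using lam by (auto intro!: tendsto_mult_left_zero LIMSEQ_power_zero)
  have "Cauchy (\<lambda>n. u n x)" for x
  proof (rule metric_CauchyI)
    fix e :: real assume "0 < e"
    then have "\<forall>\<^sub>F n in sequentially. E n < e / 2"
      using E_lim by (intro order_tendstoD) auto
    then obtain n where n: "E n < e / 2" by (auto simp: eventually_sequentially)
    have "\<bar>u m x - u n x\<bar> < e / 2" if "m \<ge> n" for m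
      using dist_u'[of n "m - n" x] n that by simp
    then show "\<exists>n. \<forall>m\<ge>n. \<forall>l\<ge>n. dist (u m x) (u l x) < e"
      by (intro exI[of _ n]) (smt (verit) dist_real_def field_sum_of_halves)
  qed
  then have "convergent (\<lambda>n. u n x)" for x
    by (simp add: Cauchy_convergent_iff)
  then obtain h where h: "(\<lambda>n. u n x) \<longlonglongrightarrow> h x" for x
    unfolding convergent_def by metis
  have close: "\<bar>h x - u n x\<bar> \<le> E n" for n x
  proof (rule LIMSEQ_le_const2)
    show "(\<lambda>k. \<bar>u (n + k) x - u n x\<bar>) \<longlonglongrightarrow> \<bar>h x - u n x\<bar>"
      using LIMSEQ_ignore_initial_segment[OF h[of x], of n]
      by (intro tendsto_rabs tendsto_diff tendsto_const) (simp add: add.commute)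
  qed (use dist_u' in blast)
  have h_meas: "h \<in> borel_measurable N"
    by (rule borel_measurable_LIMSEQ_real[where u = u]) (use u h in auto)
  have h_bdd: "bounded (range h)"
    using close[of _ 0] by (auto simp: bounded_iff u_def)
  have "T h x = h x" for x
  proof -
    have bound: "\<bar>T h x - h x\<bar> \<le> 2 * E n" for n
    proof -
      have "\<bar>T h x - u (Suc n) x\<bar> \<le> lam * E n"
        unfolding u_Suc using u h_meas h_bdd close by (intro contr) auto
      also have "lam * E n \<le> E n"
        using lam E0[of n] by (simp add: mult_left_le_one_le)
      finally have "\<bar>T h x - u (Suc n) x\<bar> \<le> E n" .
      moreover have "E (Suc n) \<le> E n"
        using dist_u[of n 1 x] by simp
      ultimately show ?thesis using close[of x "Suc n"] by linarith
    qed
    have "(\<lambda>n. 2 * E n) \<longlonglongrightarrow> 0"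
      using tendsto_mult_right_zero[OF E_lim] by simp
    then have "\<bar>T h x - h x\<bar> \<le> 0"
      by (rule LIMSEQ_le_const) (use bound in blast)
    then show ?thesis by simp
  qed
  then show ?thesis
    using that[OF h_meas h_bdd] by (simp add: fun_eq_iff)
qed

text \<open>The source \<open>X\<close> is kept apart from \<open>N\<close>: it is the state-action
  space for the controlled kernel and the state space for the chain of a stationary policy.\<close>

locale minorized_kernel =
  fixes X :: "'x measure" and N :: "'s measure" and p :: "'x \<Rightarrow> 's measure"
    and \<zeta> :: "'s measure" and lam :: real
  assumes kernel[measurable]: "p \<in> X \<rightarrow>\<^sub>M prob_algebra N"
    and minorant: "\<zeta> \<in> space (prob_algebra N)"
    and lam: "0 < lam" "lam < 1"
    and minorization: "\<And>x B. x \<in> space X \<Longrightarrow> B \<in> sets N \<Longrightarrow> (1 - lam) * measure \<zeta> B \<le> measure (p x) B"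
begin

sublocale Zeta: prob_space \<zeta>
  using minorant by (simp add: space_prob_algebra)

lemma sets_minorant: "sets \<zeta> = sets N"
  using minorant by (simp add: space_prob_algebra)

lemma space_minorant: "space \<zeta> = space N"
  using sets_minorant by (rule sets_eq_imp_space_eq)

lemma prob_space_kernel: "x \<in> space X \<Longrightarrow> prob_space (p x)"
  and sets_kernel: "x \<in> space X \<Longrightarrow> sets (p x) = sets N"
  using measurable_space[OF kernel] by (auto simp: space_prob_algebra)

text \<open>The second component in Nummelin's splitting of p. The difference has mass lam, and the
  factor 1 / lam makes it a probability measure.\<close>

definition residual :: "'x \<Rightarrow> 's measure" where
  "residual x = scale_measure (ennreal (1 / lam)) (diff_measure (p x) (scale_measure (ennreal (1 - lam)) \<zeta>))"

lemma emeasure_residual: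
  assumes x: "x \<in> space X" and A: "A \<in> sets N"
  shows "emeasure (residual x) A = ennreal ((measure (p x) A - (1 - lam) * measure \<zeta> A) / lam)"
proof -
  interpret p: prob_space "p x" using x by (rule prob_space_kernel)
  have scale: "emeasure (scale_measure (ennreal (1 - lam)) \<zeta>) B = ennreal ((1 - lam) * measure \<zeta> B)" for B
    using lam by (simp add: Zeta.emeasure_eq_measure ennreal_mult')
  have "emeasure (diff_measure (p x) (scale_measure (ennreal (1 - lam)) \<zeta>)) A =
      emeasure (p x) A - emeasure (scale_measure (ennreal (1 - lam)) \<zeta>) A"
  proof (rule emeasure_diff_measure)
    show "finite_measure (scale_measure (ennreal (1 - lam)) \<zeta>)"
      by (rule finite_measureI) (simp only: scale, simp)
    show "emeasure (scale_measure (ennreal (1 - lam)) \<zeta>) B \<le> emeasure (p x) B" if "B \<in> sets (p x)" for B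
      using minorization[OF x, of B] that x
      by (simp only: scale p.emeasure_eq_measure) (simp add: sets_kernel)
  qed (use x A in \<open>simp_all add: sets_kernel sets_minorant p.finite_measure_axioms\<close>)
  also have "\<dots> = ennreal (measure (p x) A - (1 - lam) * measure \<zeta> A)"
    using lam by (simp only: scale p.emeasure_eq_measure) (simp add: ennreal_minus)
  finally show ?thesis
    using lam minorization[OF x A]
    by (simp add: residual_def ennreal_mult'[symmetric])
qed

lemma residual_measurable[measurable]: "residual \<in> X \<rightarrow>\<^sub>M prob_algebra N"
proof (rule measurable_prob_algebra_generated[where \<Omega> = "space N" and G = "sets N"])
  show "sets N = sigma_sets (space N) (sets N)" by (rule sets.sigma_sets_eq[symmetric])
  show "Int_stable (sets N)" by (rule sets.Int_stable)
  show "sets N \<subseteq> Pow (space N)" by (rule sets.space_closed)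
  fix x assume x: "x \<in> space X"
  show sets: "sets (residual x) = sets N"
    using x by (simp add: residual_def sets_kernel)
  interpret p: prob_space "p x" using x by (rule prob_space_kernel)
  have "space (residual x) = space N" "space (p x) = space N"
    using sets sets_kernel[OF x] by (auto dest: sets_eq_imp_space_eq)
  then show "prob_space (residual x)"
    using lam p.prob_space Zeta.prob_space
    by (intro prob_spaceI) (simp add: emeasure_residual[OF x] space_minorant)
next
  fix A assume A: "A \<in> sets N"
  have "(\<lambda>x. ennreal ((measure (p x) A - (1 - lam) * measure \<zeta> A) / lam)) \<in> borel_measurable X"
    using measurable_compose[OF kernel measurable_measure_prob_algebra[OF A]] by measurable
  then show "(\<lambda>x. emeasure (residual x) A) \<in> borel_measurable X"
    by (subst measurable_cong[OF emeasure_residual[OF _ A]])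
qed

lemma integral_kernel_split:
  fixes h :: "'s \<Rightarrow> real"
  assumes x: "x \<in> space X" and h: "h \<in> borel_measurable N" "\<And>y. y \<in> space N \<Longrightarrow> \<bar>h y\<bar> \<le> B"
  shows "(\<integral>y. h y \<partial>p x) = (1 - lam) * (\<integral>y. h y \<partial>\<zeta>) + lam * (\<integral>y. h y \<partial>residual x)"
proof -
  \<comment> \<open>A convex combination of two measures is a bind over a Bernoulli variable; the
    integral then splits by the formula for binds.\<close>
  let ?b = "measure_pmf (bernoulli_pmf (1 - lam))"
  let ?k = "\<lambda>b. if b then \<zeta> else residual x"
  have res: "residual x \<in> space (prob_algebra N)"
    by (rule measurable_space[OF residual_measurable x])
  have b: "?b \<in> space (prob_algebra (count_space UNIV))"
    by (simp add: space_prob_algebra measure_pmf.prob_space_axioms)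
  have k: "?k \<in> count_space UNIV \<rightarrow>\<^sub>M prob_algebra N"
    using res minorant by (simp add: Pi_iff)
  interpret p: prob_space "p x" using x by (rule prob_space_kernel)
  have "p x = ?b \<bind> ?k"
  proof (rule measure_eqI)
    show "sets (p x) = sets (?b \<bind> ?k)"
      by (simp add: sets_bind'[OF b k] sets_kernel[OF x])
    fix A assume "A \<in> sets (p x)"
    then have A: "A \<in> sets N" by (simp add: sets_kernel[OF x])
    have "emeasure (?b \<bind> ?k) A = (\<integral>\<^sup>+c. emeasure (?k c) A \<partial>?b)"
      by (rule emeasure_bind_prob_algebra[OF b k A])
    also have "\<dots> = emeasure \<zeta> A * ennreal (1 - lam) + emeasure (residual x) A * ennreal lam"
      using lam by (simp add: nn_integral_bernoulli_pmf)
    also have "\<dots> = ennreal (measure (p x) A)"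
      using lam minorization[OF x A]
      by (simp add: emeasure_residual[OF x A] Zeta.emeasure_eq_measure ennreal_mult''[symmetric]
          ennreal_plus[symmetric] del: ennreal_plus)
    finally show "emeasure (p x) A = emeasure (?b \<bind> ?k) A"
      by (simp add: p.emeasure_eq_measure)
  qed
  then have "(\<integral>y. h y \<partial>p x) = (\<integral>c. (\<integral>y. h y \<partial>?k c) \<partial>?b)"
    using integral_bind_prob_algebra[OF b k h] by simp
  then show ?thesis
    using lam by (simp add: mult.commute)
qed

lemma abs_integral_residual_le:
  fixes h :: "'s \<Rightarrow> real"
  assumes x: "x \<in> space X" and h: "h \<in> borel_measurable N" "\<And>y. y \<in> space N \<Longrightarrow> \<bar>h y\<bar> \<le> B"
  shows "\<bar>\<integral>y. h y \<partial>residual x\<bar> \<le> B"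
proof -
  have *: "residual x \<in> space (prob_algebra N)"
    by (rule measurable_space[OF residual_measurable x])
  then interpret prob_space "residual x" by (simp add: space_prob_algebra)
  from * have sets: "sets (residual x) = sets N" by (simp add: space_prob_algebra)
  from sets_eq_imp_space_eq[OF this] sets show ?thesis
    using h by (intro abs_integral_le_bound) (auto cong: measurable_cong_sets)
qed

lemma integral_residual_measurable:
  fixes h :: "'s \<Rightarrow> real"
  assumes "h \<in> borel_measurable N"
  shows "(\<lambda>x. \<integral>y. h y \<partial>residual x) \<in> borel_measurable X"
  by (rule measurable_compose[OF measurable_prob_algebraD[OF residual_measurable]
        integral_measurable_subprob_algebra[OF assms]])

lemma abs_integral_residual_diff_le:
  fixes h h' :: "'s \<Rightarrow> real"
  assumes x: "x \<in> space X"
    and h: "h \<in> borel_measurable N" "\<And>y. y \<in> space N \<Longrightarrow> \<bar>h y\<bar> \<le> B"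
    and h': "h' \<in> borel_measurable N" "\<And>y. y \<in> space N \<Longrightarrow> \<bar>h' y\<bar> \<le> B'"
    and d: "\<And>y. y \<in> space N \<Longrightarrow> \<bar>h y - h' y\<bar> \<le> d"
  shows "\<bar>(\<integral>y. h y \<partial>residual x) - (\<integral>y. h' y \<partial>residual x)\<bar> \<le> d"
proof -
  have *: "residual x \<in> space (prob_algebra N)"
    by (rule measurable_space[OF residual_measurable x])
  then interpret prob_space "residual x" by (simp add: space_prob_algebra)
  from * have sets: "sets (residual x) = sets N" by (simp add: space_prob_algebra)
  note sp = sets_eq_imp_space_eq[OF sets]
  have "integrable (residual x) h" "integrable (residual x) h'"
    using h h' sets sp by (auto intro!: integrable_bounded[of h B] integrable_bounded[of h' B'] cong: measurable_cong_sets)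
  then have "(\<integral>y. h y \<partial>residual x) - (\<integral>y. h' y \<partial>residual x) = (\<integral>y. h y - h' y \<partial>residual x)"
    by simp
  also have "\<bar>\<dots>\<bar> \<le> d"
    using abs_integral_residual_le[OF x _ d] h h' by simp
  finally show ?thesis .
qed

end

section \<open>An invariant measure built from restarts\<close>

text \<open>A chain with kernel \<open>(1 - lam) \<zeta> + lam residual\<close> restarts from \<open>\<zeta>\<close> with probability
  \<open>1 - lam\<close> at each step; the age of the current excursion is geometrically distributed under the
  invariant measure.\<close>

locale minorized_chain = minorized_kernel N N p \<zeta> lam
  for N :: "'s measure" and p \<zeta> lam
begin

text \<open>The law of the state n steps after a restart, namely \<zeta> q^n with q the residual
  kernel.\<close>

definition excursion :: "nat \<Rightarrow> 's measure" where
  "excursion n = ((\<lambda>m. m \<bind> residual) ^^ n) \<zeta>"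

lemma excursion_in_prob_algebra: "excursion n \<in> space (prob_algebra N)"
proof (induction n)
  case 0 then show ?case by (simp add: excursion_def minorant)
next
  case (Suc n)
  then show ?case
    using prob_space_bind'[OF Suc residual_measurable] sets_bind'[OF Suc residual_measurable]
    by (simp add: excursion_def space_prob_algebra)
qed

text \<open>The series of (1 - lam) lam^n \<zeta> q^n over n, written as a mixture over a geometric
  age.\<close>

definition invariant :: "'s measure" where
  "invariant = measure_pmf (geometric_pmf (1 - lam)) \<bind> excursion"

lemma geometric_in_prob_algebra:
  "measure_pmf (geometric_pmf (1 - lam)) \<in> space (prob_algebra (count_space UNIV))"
  by (simp add: space_prob_algebra measure_pmf.prob_space_axioms)

lemma excursion_measurable: "excursion \<in> count_space UNIV \<rightarrow>\<^sub>M prob_algebra N"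
  using excursion_in_prob_algebra by (simp add: Pi_iff)

lemma invariant_in_prob_algebra: "invariant \<in> space (prob_algebra N)"
  using prob_space_bind'[OF geometric_in_prob_algebra excursion_measurable]
    sets_bind'[OF geometric_in_prob_algebra excursion_measurable]
  by (simp add: invariant_def space_prob_algebra)

text \<open>A geometric age is 0 with probability 1 - lam and otherwise one more than a geometric
  age; each further unit of age is one application of \<open>residual\<close>. By the splitting of
  p, this is invariance tested on h.\<close>

lemma integral_invariant:
  fixes h :: "'s \<Rightarrow> real"
  assumes h: "h \<in> borel_measurable N" and B: "\<And>y. y \<in> space N \<Longrightarrow> \<bar>h y\<bar> \<le> B"
  shows "(\<integral>y. h y \<partial>invariant) = (1 - lam) * (\<integral>y. h y \<partial>\<zeta>) + lam * (\<integral>y. (\<integral>y'. h y' \<partial>residual y) \<partial>invariant)"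
proof -
  let ?F = "\<lambda>n. \<integral>y. h y \<partial>excursion n" and ?G = "geometric_pmf (1 - lam)"
  have F: "\<bar>?F n\<bar> \<le> B" for n
  proof -
    have *: "excursion n \<in> space (prob_algebra N)" by (rule excursion_in_prob_algebra)
    then interpret prob_space "excursion n" by (simp add: space_prob_algebra)
    from * have sets: "sets (excursion n) = sets N" by (simp add: space_prob_algebra)
    from sets_eq_imp_space_eq[OF this] sets show ?thesis
      using h B by (intro abs_integral_le_bound) (auto cong: measurable_cong_sets)
  qed
  have excursion_Suc: "?F (Suc n) = (\<integral>y. (\<integral>y'. h y' \<partial>residual y) \<partial>excursion n)" for n
    using integral_bind_prob_algebra[OF excursion_in_prob_algebra[of n] residual_measurable h B]
    by (simp add: excursion_def)
  have "(\<integral>y. h y \<partial>invariant) = (\<integral>n. ?F n \<partial>?G)"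
    unfolding invariant_def
    by (rule integral_bind_prob_algebra[OF geometric_in_prob_algebra excursion_measurable h B])
  also have "\<dots> = (\<integral>n. ?F n \<partial>bind_pmf (bernoulli_pmf (1 - lam)) (\<lambda>b. if b then return_pmf 0 else map_pmf Suc ?G))"
    using lam by (subst geometric_bind_pmf_unfold[of "1 - lam"]) simp_all
  also have "\<dots> = (\<integral>b. (\<integral>n. ?F n \<partial>(if b then return_pmf 0 else map_pmf Suc ?G)) \<partial>bernoulli_pmf (1 - lam))"
    unfolding measure_pmf_bind
    by (rule integral_bind_prob_algebra[where N = "count_space UNIV" and L = "count_space UNIV" and B = B])
      (use F in \<open>auto simp: space_prob_algebra measure_pmf.prob_space_axioms\<close>)
  also have "\<dots> = (1 - lam) * ?F 0 + lam * (\<integral>n. ?F (Suc n) \<partial>?G)"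
    using lam by (simp add: mult.commute)
  also have "(\<integral>n. ?F (Suc n) \<partial>?G) = (\<integral>y. (\<integral>y'. h y' \<partial>residual y) \<partial>invariant)"
    unfolding excursion_Suc invariant_def
    by (rule integral_bind_prob_algebra[symmetric, OF geometric_in_prob_algebra excursion_measurable
          integral_residual_measurable[OF h] abs_integral_residual_le[OF _ h B]])
  finally show ?thesis by (simp add: excursion_def)
qed

lemma invariant_bind: "invariant \<bind> p = invariant"
proof (rule measure_eqI)
  interpret inv: prob_space invariant
    using invariant_in_prob_algebra by (simp add: space_prob_algebra)
  have sets: "sets invariant = sets N"
    using invariant_in_prob_algebra by (simp add: space_prob_algebra)
  note space = sets_eq_imp_space_eq[OF sets]
  interpret bind: prob_space "invariant \<bind> p"
    by (rule prob_space_bind'[OF invariant_in_prob_algebra kernel])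
  have sets_bind: "sets (invariant \<bind> p) = sets N"
    by (rule sets_bind'[OF invariant_in_prob_algebra kernel])
  then show "sets (invariant \<bind> p) = sets invariant" by (simp add: sets)
  fix A assume "A \<in> sets (invariant \<bind> p)"
  then have A: "A \<in> sets N" by (simp add: sets_bind)
  then have h: "indicat_real A \<in> borel_measurable N" and B: "\<And>y. \<bar>indicat_real A y\<bar> \<le> 1"
    by (auto simp: indicator_def)
  have int: "integrable invariant (\<lambda>y. \<integral>y'. indicat_real A y' \<partial>residual y)"
    using abs_integral_residual_le[OF _ h B] integral_residual_measurable[OF h] sets
    by (intro inv.integrable_bounded[of _ 1]) (auto simp: space cong: measurable_cong_sets)
  have "(\<integral>y. indicat_real A y \<partial>(invariant \<bind> p)) = (\<integral>y. (\<integral>y'. indicat_real A y' \<partial>p y) \<partial>invariant)"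
    by (rule integral_bind_prob_algebra[OF invariant_in_prob_algebra kernel h B])
  also have "\<dots> = (\<integral>y. (1 - lam) * (\<integral>y'. indicat_real A y' \<partial>\<zeta>) + lam * (\<integral>y'. indicat_real A y' \<partial>residual y) \<partial>invariant)"
    by (rule Bochner_Integration.integral_cong[OF refl], rule integral_kernel_split[OF _ h B]) (simp add: space)
  also have "\<dots> = (\<integral>y. indicat_real A y \<partial>invariant)"
    unfolding integral_invariant[OF h B] using int by (simp add: inv.prob_space)
  finally show "emeasure (invariant \<bind> p) A = emeasure invariant A"
    using A by (simp add: inv.emeasure_eq_measure bind.emeasure_eq_measure sets_bind sets)
qed

end

section \<open>Poisson equation and uniqueness of the invariant measure\<close>

context minorized_chain
begin

text \<open>A fixed point of g \<mapsto> \<phi> + lam q g, with q the residual kernel, solves the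
  equation for r = (1 - lam) \<integral>g d\<zeta>: adding r to both sides turns lam q g into p
  g.\<close>

lemma poisson_equation:
  fixes \<phi> :: "'s \<Rightarrow> real"
  assumes space: "space N = UNIV" and \<phi>: "\<phi> \<in> borel_measurable N" "\<And>y. \<bar>\<phi> y\<bar> \<le> K"
  obtains g r where "g \<in> borel_measurable N" "\<And>y. \<bar>g y\<bar> \<le> K / (1 - lam)"
    "\<And>y. r + g y = \<phi> y + (\<integral>y'. g y' \<partial>p y)"
proof -
  define T where "T h y = \<phi> y + lam * (\<integral>y'. h y' \<partial>residual y)" for h y
  obtain g where g: "g \<in> borel_measurable N" "bounded (range g)" "T g = g"
  proof (rule contraction_fixed_point[of lam N T])
    show "0 \<le> lam" "lam < 1" using lam by auto
    fix h :: "'s \<Rightarrow> real" assume h: "h \<in> borel_measurable N" "bounded (range h)"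
    then obtain B where B: "\<And>y. \<bar>h y\<bar> \<le> B" by (auto simp: bounded_iff)
    have "\<bar>T h y\<bar> \<le> K + lam * B" for y
    proof -
      have "\<bar>lam * (\<integral>y'. h y' \<partial>residual y)\<bar> \<le> lam * B"
        using lam abs_integral_residual_le[OF _ h(1) B, of y] by (simp add: abs_mult space)
      then show ?thesis using \<phi>(2)[of y] unfolding T_def by linarith
    qed
    moreover have "T h \<in> borel_measurable N"
      unfolding T_def[abs_def] using \<phi>(1) integral_residual_measurable[OF h(1)] by measurable
    ultimately show "T h \<in> borel_measurable N \<and> bounded (range (T h))"
      by (auto simp: bounded_iff)
    fix h' :: "'s \<Rightarrow> real" and d y
    assume h': "h' \<in> borel_measurable N" "bounded (range h')" and d: "\<And>x. \<bar>h x - h' x\<bar> \<le> d"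
    from h' obtain B' where B': "\<And>y. \<bar>h' y\<bar> \<le> B'" by (auto simp: bounded_iff)
    show "\<bar>T h y - T h' y\<bar> \<le> lam * d"
      using abs_integral_residual_diff_le[OF _ h(1) B h'(1) B' d, of y] lam
      by (simp add: T_def space abs_mult right_diff_distrib[symmetric])
  qed
  from g(2) obtain B where B: "\<And>y. \<bar>g y\<bar> \<le> B" by (auto simp: bounded_iff)
  \<comment> \<open>The contraction argument gives some bound on g only. The supremum s satisfies s
    \<le> K + lam s, which yields K / (1 - lam), a constant that does not involve the
    kernel.\<close>
  define s where "s = (SUP y. \<bar>g y\<bar>)"
  have bdd: "bdd_above (range (\<lambda>y. \<bar>g y\<bar>))" using B by (auto simp: bdd_above_def)
  have s: "\<bar>g y\<bar> \<le> s" for y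
    unfolding s_def by (rule cSUP_upper[OF _ bdd]) simp
  have "\<bar>g y\<bar> \<le> K + lam * s" for y
  proof -
    have "\<bar>lam * (\<integral>y'. g y' \<partial>residual y)\<bar> \<le> lam * s"
      using lam abs_integral_residual_le[OF _ g(1) s, of y] by (simp add: abs_mult space)
    then show ?thesis
      using \<phi>(2)[of y] fun_cong[OF g(3), of y] unfolding T_def by linarith
  qed
  then have "s \<le> K + lam * s"
    unfolding s_def by (intro cSUP_least) (auto simp: s_def)
  then have "s \<le> K / (1 - lam)"
    using lam by (simp add: field_simps)
  then have g_le: "\<bar>g y\<bar> \<le> K / (1 - lam)" for y
    using s[of y] by linarith
  have "(1 - lam) * (\<integral>y. g y \<partial>\<zeta>) + g y = \<phi> y + (\<integral>y'. g y' \<partial>p y)" for y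
    using integral_kernel_split[OF _ g(1) B, of y] fun_cong[OF g(3), of y]
    by (simp add: T_def space)
  with that[OF g(1) g_le] show ?thesis by blast
qed

text \<open>Integrated against an invariant \<mu>, the Poisson equation loses both g-terms and
  leaves r.\<close>

lemma integral_invariant_eq:
  fixes \<phi> g :: "'s \<Rightarrow> real"
  assumes \<mu>: "\<mu> \<in> space (prob_algebra N)" "\<mu> \<bind> p = \<mu>"
    and \<phi>: "\<phi> \<in> borel_measurable N" "\<And>y. \<bar>\<phi> y\<bar> \<le> K"
    and g: "g \<in> borel_measurable N" "\<And>y. \<bar>g y\<bar> \<le> B"
    and poisson: "\<And>y. r + g y = \<phi> y + (\<integral>y'. g y' \<partial>p y)"
  shows "(\<integral>y. \<phi> y \<partial>\<mu>) = r"
proof -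
  interpret prob_space \<mu> using \<mu>(1) by (simp add: space_prob_algebra)
  have sets: "sets \<mu> = sets N" using \<mu>(1) by (simp add: space_prob_algebra)
  have int: "integrable \<mu> \<phi>" "integrable \<mu> g"
    using \<phi> g sets by (auto intro!: integrable_bounded[of \<phi> K] integrable_bounded[of g B] cong: measurable_cong_sets)
  have "(\<integral>y. g y \<partial>\<mu>) = (\<integral>y. (\<integral>y'. g y' \<partial>p y) \<partial>\<mu>)"
    using integral_bind_prob_algebra[OF \<mu>(1) kernel g] by (simp add: \<mu>(2))
  also have "\<dots> = (\<integral>y. r + g y - \<phi> y \<partial>\<mu>)"
    by (simp add: poisson)
  finally show ?thesis using int by (simp add: prob_space)
qed

text \<open>For uniqueness, solve the Poisson equation with cost \<open>indicat_real A\<close>: its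
  constant r is the mass that every invariant probability measure gives to A.\<close>

lemma ex1_invariant:
  assumes space: "space N = UNIV"
  shows "\<exists>!\<mu>. \<mu> \<in> space (prob_algebra N) \<and> \<mu> \<bind> p = \<mu>"
proof (rule ex1I)
  show "invariant \<in> space (prob_algebra N) \<and> invariant \<bind> p = invariant"
    using invariant_in_prob_algebra invariant_bind by simp
  fix \<mu> assume \<mu>: "\<mu> \<in> space (prob_algebra N) \<and> \<mu> \<bind> p = \<mu>"
  show "\<mu> = invariant"
  proof (rule measure_eqI)
    show "sets \<mu> = sets invariant"
      using \<mu> invariant_in_prob_algebra by (simp add: space_prob_algebra)
    interpret \<mu>: prob_space \<mu> using \<mu> by (simp add: space_prob_algebra)
    interpret inv: prob_space invariant
      using invariant_in_prob_algebra by (simp add: space_prob_algebra)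
    fix A assume "A \<in> sets \<mu>"
    then have A: "A \<in> sets N" using \<mu> by (simp add: space_prob_algebra)
    then have \<phi>: "indicat_real A \<in> borel_measurable N" and B: "\<And>y. \<bar>indicat_real A y\<bar> \<le> 1"
      by (auto simp: indicator_def)
    obtain g r where g: "g \<in> borel_measurable N" "\<And>y. \<bar>g y\<bar> \<le> 1 / (1 - lam)"
      "\<And>y. r + g y = indicat_real A y + (\<integral>y'. g y' \<partial>p y)"
      using poisson_equation[OF space \<phi> B] by metis
    have "(\<integral>y. indicat_real A y \<partial>\<mu>) = (\<integral>y. indicat_real A y \<partial>invariant)"
      using integral_invariant_eq[OF _ _ \<phi> B g, of \<mu>] \<mu>
        integral_invariant_eq[OF invariant_in_prob_algebra invariant_bind \<phi> B g] by simp
    moreover have "space \<mu> = space N" "space invariant = space N"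
      using \<mu> invariant_in_prob_algebra by (auto simp: space_prob_algebra dest: sets_eq_imp_space_eq)
    ultimately have "measure \<mu> A = measure invariant A"
      by (simp add: space)
    then show "emeasure \<mu> A = emeasure invariant A"
      by (simp add: \<mu>.emeasure_eq_measure inv.emeasure_eq_measure)
  qed
qed

end

section \<open>The optimality equation\<close>

locale doeblin_mdp = minorized_kernel "borel \<Otimes>\<^sub>M borel" borel "trans_kernel M" \<zeta> lam
  for M :: "('z::polish_space, 'a::polish_space) mdp" and \<zeta> lam +
  fixes K :: real
  assumes states: "states M = borel" and actions: "actions M = borel"
    and cost_measurable[measurable]: "stage_cost M \<in> borel_measurable (borel \<Otimes>\<^sub>M borel)"
    and cost_bounded: "\<bar>stage_cost M x\<bar> \<le> K"
begin

lemma is_mdp: "is_mdp M"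
  using kernel cost_measurable by (simp add: is_mdp_def states actions)

definition one_step :: "('z \<Rightarrow> real) \<Rightarrow> 'z \<times> 'a \<Rightarrow> real" where
  "one_step h x = stage_cost M x + (\<integral>y. h y \<partial>trans_kernel M x)"

lemma stationary_poisson:
  assumes f: "f \<in> borel \<rightarrow>\<^sub>M borel"
  obtains g where "g \<in> borel_measurable borel" "\<And>z. \<bar>g z\<bar> \<le> K / (1 - lam)"
    "\<And>z. stationary_cost M f + g z = one_step g (z, f z)"
proof -
  have f'[measurable]: "(\<lambda>z. (z, f z)) \<in> borel \<rightarrow>\<^sub>M borel \<Otimes>\<^sub>M borel"
    using f by measurable
  interpret chain: minorized_chain borel "\<lambda>z. trans_kernel M (z, f z)" \<zeta> lam
    by unfold_locales
      (use minorant lam minorization measurable_compose[OF f' kernel] in \<open>auto simp: space_pair_measure\<close>)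
  have \<phi>: "(\<lambda>z. stage_cost M (z, f z)) \<in> borel_measurable borel"
    by measurable
  obtain g r where g: "g \<in> borel_measurable borel" "\<And>z. \<bar>g z\<bar> \<le> K / (1 - lam)"
    "\<And>z. r + g z = stage_cost M (z, f z) + (\<integral>y. g y \<partial>trans_kernel M (z, f z))"
    using chain.poisson_equation[OF space_borel \<phi> cost_bounded] by metis
  \<comment> \<open>Uniqueness is what makes the \<open>THE\<close> in
    \<open>stationary_cost\<close> denote an invariant measure; then r is the integral of the cost
    against it.\<close>
  have "invariant_measure M f (THE \<mu>. invariant_measure M f \<mu>)"
    unfolding invariant_measure_def states by (rule theI'[OF chain.ex1_invariant[OF space_borel]])
  then have "stationary_cost M f = r"
    unfolding stationary_cost_def invariant_measure_def states
    using chain.integral_invariant_eq[OF _ _ \<phi> cost_bounded g] by blast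
  with that[OF g(1,2)] g(3) show ?thesis by (simp add: one_step_def)
qed

lemma average_cost_stationary:
  assumes f: "f \<in> borel \<rightarrow>\<^sub>M borel"
  shows "average_cost M (stationary_policy M f) z = ereal (stationary_cost M f)"
proof -
  obtain g where g: "g \<in> borel_measurable borel" "\<And>z. \<bar>g z\<bar> \<le> K / (1 - lam)"
    "\<And>z. stationary_cost M f + g z = one_step g (z, f z)"
    using stationary_poisson[OF f] by metis
  have "one_step g (x, f x) - g x = stationary_cost M f" for x
    using g(3)[of x] by simp
  then show ?thesis
    using average_cost_stationary_ge[OF is_mdp, of f z g "K / (1 - lam)" K "stationary_cost M f"]
      average_cost_stationary_le[OF is_mdp, of f z g "K / (1 - lam)" K "stationary_cost M f"] f g cost_bounded
    by (intro antisym) (simp_all add: states actions one_step_def)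
qed

lemma abs_one_step_le:
  assumes "h \<in> borel_measurable borel" "\<And>z. \<bar>h z\<bar> \<le> B"
  shows "\<bar>one_step h x\<bar> \<le> K + B"
proof -
  have x: "x \<in> space (borel \<Otimes>\<^sub>M borel)" by (simp add: space_pair_measure)
  interpret prob_space "trans_kernel M x" by (rule prob_space_kernel[OF x])
  have "\<bar>\<integral>y. h y \<partial>trans_kernel M x\<bar> \<le> B"
    using assms by (intro abs_integral_le_bound) (auto simp: sets_kernel[OF x] cong: measurable_cong_sets)
  with cost_bounded[of x] show ?thesis
    unfolding one_step_def by linarith
qed

end

lemma abs_INF_diff_le:
  fixes u v :: "'a \<Rightarrow> real"
  assumes "\<And>a. \<bar>u a\<bar> \<le> B" "\<And>a. \<bar>v a\<bar> \<le> B'" and d: "\<And>a. \<bar>u a - v a\<bar> \<le> d"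
  shows "\<bar>(INF a. u a) - (INF a. v a)\<bar> \<le> d"
proof -
  have bdd: "bdd_below (range u)" "bdd_below (range v)"
    using assms(1,2) by (auto simp: abs_le_iff minus_le_iff intro: bdd_belowI2[of _ "- B" u] bdd_belowI2[of _ "- B'" v])
  have "(INF a. u a) - d \<le> (INF a. v a)"
  proof (rule cINF_greatest)
    fix a show "(INF a. u a) - d \<le> v a"
      using cINF_lower[OF bdd(1), of a] d[of a] by simp
  qed simp
  moreover have "(INF a. v a) - d \<le> (INF a. u a)"
  proof (rule cINF_greatest)
    fix a show "(INF a. v a) - d \<le> u a"
      using cINF_lower[OF bdd(2), of a] d[of a] by simp
  qed simp
  ultimately show ?thesis by linarith
qed

text \<open>One \<open>d\<close> serves all measurable h bounded by \<open>B\<close>. This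
  uniformity is what continuity in total variation provides, and it covers functions that are
  discontinuous or vary with n.\<close>

locale equicontinuous_mdp = doeblin_mdp M \<zeta> lam K
  for M :: "('z::polish_space, 'a::polish_space) mdp" and \<zeta> lam K +
  assumes modulus: "0 < B \<Longrightarrow> 0 < e \<Longrightarrow> \<exists>d>0. \<forall>x y. dist x y < d \<longrightarrow>
    \<bar>stage_cost M x - stage_cost M y\<bar> \<le> e \<and>
    (\<forall>h\<in>borel_measurable borel. (\<forall>z. \<bar>h z\<bar> \<le> B) \<longrightarrow>
       \<bar>(\<integral>z. h z \<partial>trans_kernel M x) - (\<integral>z. h z \<partial>trans_kernel M y)\<bar> \<le> e)"
begin

lemma one_step_modulus:
  assumes "0 < B" "0 < e"
  obtains d where "0 < d" "\<And>h x y. h \<in> borel_measurable borel \<Longrightarrow> (\<And>z. \<bar>h z\<bar> \<le> B) \<Longrightarrow>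
    dist x y < d \<Longrightarrow> \<bar>one_step h x - one_step h y\<bar> \<le> e"
proof -
  obtain d where d: "0 < d" "\<And>x y. dist x y < d \<Longrightarrow>
    \<bar>stage_cost M x - stage_cost M y\<bar> \<le> e / 2 \<and>
    (\<forall>h\<in>borel_measurable borel. (\<forall>z. \<bar>h z\<bar> \<le> B) \<longrightarrow>
       \<bar>(\<integral>z. h z \<partial>trans_kernel M x) - (\<integral>z. h z \<partial>trans_kernel M y)\<bar> \<le> e / 2)"
    using modulus[of B "e / 2"] assms by auto
  have "\<bar>one_step h x - one_step h y\<bar> \<le> e"
    if "h \<in> borel_measurable borel" "\<And>z. \<bar>h z\<bar> \<le> B" "dist x y < d" for h x y
  proof -
    have "\<bar>stage_cost M x - stage_cost M y\<bar> \<le> e / 2"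
      "\<bar>(\<integral>z. h z \<partial>trans_kernel M x) - (\<integral>z. h z \<partial>trans_kernel M y)\<bar> \<le> e / 2"
      using d(2)[OF that(3)] that(1,2) by auto
    then show ?thesis unfolding one_step_def by linarith
  qed
  with d(1) that show ?thesis by blast
qed

lemma INF_one_step_modulus:
  assumes "0 < B" "0 < e"
  obtains d where "0 < d" "\<And>h z z'. h \<in> borel_measurable borel \<Longrightarrow> (\<And>z. \<bar>h z\<bar> \<le> B) \<Longrightarrow>
    dist z z' < d \<Longrightarrow> \<bar>(INF a. one_step h (z, a)) - (INF a. one_step h (z', a))\<bar> \<le> e"
proof -
  obtain d where d: "0 < d" "\<And>h x y. h \<in> borel_measurable borel \<Longrightarrow> (\<And>z. \<bar>h z\<bar> \<le> B) \<Longrightarrow>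
    dist x y < d \<Longrightarrow> \<bar>one_step h x - one_step h y\<bar> \<le> e"
    using one_step_modulus[OF assms] by metis
  have "\<bar>(INF a. one_step h (z, a)) - (INF a. one_step h (z', a))\<bar> \<le> e"
    if h: "h \<in> borel_measurable borel" "\<And>z. \<bar>h z\<bar> \<le> B" and "dist z z' < d" for h z z'
    by (rule abs_INF_diff_le[OF abs_one_step_le[OF h] abs_one_step_le[OF h] d(2)[OF h]])
      (simp add: dist_Pair_Pair that(3))
  with d(1) that show ?thesis by blast
qed

text \<open>Subtracting (1 - lam) \<integral>h d\<zeta> from the dynamic programming operator leaves
  the infimum of c + lam q h with q the residual kernel, which is a contraction. At the fixed point
  the subtracted constant reappears as \<open>r\<close>.\<close>

lemma optimality_equation:
  obtains h B r where "h \<in> borel_measurable borel" "0 < B" "\<And>z. \<bar>h z\<bar> \<le> B"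
    "\<And>z. r + h z = (INF a. one_step h (z, a))"
proof -
  define I where "I h = (1 - lam) * (\<integral>y. h y \<partial>\<zeta>)" for h :: "'z \<Rightarrow> real"
  define T where "T h z = (INF a. one_step h (z, a)) - I h" for h z
  have sp: "x \<in> space (borel \<Otimes>\<^sub>M borel)" for x :: "'z \<times> 'a"
    by (simp add: space_pair_measure)
  have one_step: "one_step h x - I h = stage_cost M x + lam * (\<integral>y. h y \<partial>residual x)"
    if "h \<in> borel_measurable borel" "\<And>z. \<bar>h z\<bar> \<le> B" for h x B
    using integral_kernel_split[OF sp, of h B x] that by (simp add: one_step_def I_def)
  have T: "T h z = (INF a. one_step h (z, a) - I h)"
    if h: "h \<in> borel_measurable borel" "\<And>z. \<bar>h z\<bar> \<le> B" for h z B
  proof -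
    have "bdd_below (range (\<lambda>a. one_step h (z, a)))"
      using abs_one_step_le[OF h] by (intro bdd_belowI2[of _ "- (K + B)"]) (simp add: abs_le_iff minus_le_iff)
    then show ?thesis
      using Inf_add_eq[of "\<lambda>a. one_step h (z, a)" UNIV "- I h"] by (simp add: T_def)
  qed
  obtain h where h: "h \<in> borel_measurable borel" "bounded (range h)" "T h = h"
  proof (rule contraction_fixed_point[of lam borel T])
    show "0 \<le> lam" "lam < 1" using lam by auto
    fix h :: "'z \<Rightarrow> real" assume h: "h \<in> borel_measurable borel" "bounded (range h)"
    then obtain B where B: "0 < B" "\<And>y. \<bar>h y\<bar> \<le> B" by (auto simp: bounded_pos)
    have bound: "\<bar>one_step h x - I h\<bar> \<le> K + lam * B" for x
    proof -
      have "\<bar>lam * (\<integral>y. h y \<partial>residual x)\<bar> \<le> lam * B"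
        using lam abs_integral_residual_le[OF sp h(1) B(2)] by (simp add: abs_mult)
      then show ?thesis using one_step[OF h(1) B(2)] cost_bounded[of x] by (smt (verit))
    qed
    have "\<bar>T h z\<bar> \<le> K + lam * B" for z
      unfolding T[OF h(1) B(2)]
      by (rule cInf_abs_ge) (use bound in auto)
    \<comment> \<open>The infimum runs over possibly uncountably many actions, so its measurability
      is derived from continuity in z, which the common modulus provides.\<close>
    moreover have "continuous_on UNIV (T h)"
    proof (rule continuous_onI)
      fix z :: 'z and e :: real assume e: "0 < e"
      then obtain d where "0 < d" "\<And>h z z'. h \<in> borel_measurable borel \<Longrightarrow> (\<And>z. \<bar>h z\<bar> \<le> B) \<Longrightarrow>
          dist z z' < d \<Longrightarrow> \<bar>(INF a. one_step h (z, a)) - (INF a. one_step h (z', a))\<bar> \<le> e"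
        using INF_one_step_modulus[OF B(1)] by metis
      then show "\<exists>d>0. \<forall>z'\<in>UNIV. dist z' z < d \<longrightarrow> dist (T h z') (T h z) \<le> e"
        using h(1) B(2) by (intro exI[of _ d]) (auto simp: dist_real_def T_def)
    qed
    then have "T h \<in> borel_measurable borel"
      by (rule borel_measurable_continuous_onI)
    ultimately show "T h \<in> borel_measurable borel \<and> bounded (range (T h))"
      by (auto simp: bounded_iff)
    fix h' :: "'z \<Rightarrow> real" and d z
    assume h': "h' \<in> borel_measurable borel" "bounded (range h')" and d: "\<And>x. \<bar>h x - h' x\<bar> \<le> d"
    from h' obtain B' where B': "\<And>y. \<bar>h' y\<bar> \<le> B'" by (auto simp: bounded_iff)
    have bound': "\<bar>one_step h' x - I h'\<bar> \<le> K + lam * B'" for x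
    proof -
      have "\<bar>lam * (\<integral>y. h' y \<partial>residual x)\<bar> \<le> lam * B'"
        using lam abs_integral_residual_le[OF sp h'(1) B'] by (simp add: abs_mult)
      then show ?thesis using one_step[OF h'(1) B'] cost_bounded[of x] by (smt (verit))
    qed
    show "\<bar>T h z - T h' z\<bar> \<le> lam * d"
      unfolding T[OF h(1) B(2)] T[OF h'(1) B']
    proof (rule abs_INF_diff_le[OF bound bound'])
      fix a
      show "\<bar>one_step h (z, a) - I h - (one_step h' (z, a) - I h')\<bar> \<le> lam * d"
        using abs_integral_residual_diff_le[OF sp h(1) B(2) h'(1) B' d, of "(z, a)"] lam
        by (simp add: one_step[OF h(1) B(2)] one_step[OF h'(1) B'] abs_mult right_diff_distrib[symmetric])
    qed
  qed
  from h(2) obtain B where B: "0 < B" "\<And>y. \<bar>h y\<bar> \<le> B" by (auto simp: bounded_pos)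
  have "I h + h z = (INF a. one_step h (z, a))" for z
    using fun_cong[OF h(3), of z] by (simp add: T_def)
  with that[OF h(1) B] show ?thesis by blast
qed

end

section \<open>Finite-state models\<close>

lemma measurable_swap_pair:
  assumes "p \<in> borel \<Otimes>\<^sub>M borel \<rightarrow>\<^sub>M N"
  shows "(\<lambda>(a, z). p (z, a)) \<in> borel \<Otimes>\<^sub>M borel \<rightarrow>\<^sub>M N"
  using measurable_compose[OF measurable_pair_swap' assms] by (simp add: case_prod_beta')

locale quantized_mdp = doeblin_mdp M \<zeta> lam K
  for M :: "('z::polish_space, 'a::polish_space) mdp" and \<zeta> lam K +
  fixes n :: nat and Z :: "'z set" and Q :: "'z \<Rightarrow> 'z" and \<nu> :: "'z measure"
  assumes quantizer: "nearest_quantizer n Z Q"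
    and weights: "prob_space \<nu>" "sets \<nu> = sets borel"
    and cell_pos: "w \<in> Z \<Longrightarrow> 0 < measure \<nu> (cell Q w)"
begin

abbreviation FM where "FM \<equiv> finite_model M Z Q \<nu>"

lemma finite_Z: "finite Z" and Z_nonempty: "Z \<noteq> {}"
  and Q_measurable: "Q \<in> borel \<rightarrow>\<^sub>M count_space Z"
  using quantizer by (auto simp: nearest_quantizer_def)

lemma Q_in: "Q z \<in> Z"
  using quantizer by (auto simp: nearest_quantizer_def is_arg_min_def)

lemma Q_nearest: "w \<in> Z \<Longrightarrow> dist z (Q z) \<le> dist z w"
  using quantizer by (auto simp: nearest_quantizer_def is_arg_min_def not_less)

lemma Q_id: "w \<in> Z \<Longrightarrow> Q w = w"
  using Q_nearest[of w w] by simp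

lemma dist_Q: "dist z (Q z) < 1 / real n"
proof -
  have "(MIN w\<in>Z. dist z w) \<in> (\<lambda>w. dist z w) ` Z"
    using finite_Z Z_nonempty by (intro Min_in) auto
  then obtain w where "w \<in> Z" "dist z w = (MIN w\<in>Z. dist z w)" by auto
  with Q_nearest[of w z] quantizer show ?thesis
    by (auto simp: nearest_quantizer_def intro: le_less_trans)
qed

lemma cell_sets: "w \<in> Z \<Longrightarrow> cell Q w \<in> sets borel"
  using measurable_sets[OF Q_measurable, of "{w}"] by (simp add: cell_def vimage_def)

lemma states_FM: "states FM = count_space Z" and actions_FM: "actions FM = borel"
  by (simp_all add: finite_model_def actions)

lemma cell_measure_in_prob_algebra: "w \<in> Z \<Longrightarrow> cell_measure \<nu> Q w \<in> space (prob_algebra borel)"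
  using cell_pos[of w] weights
  by (auto simp: space_prob_algebra cell_measure_def measure_def intro!: prob_space_uniform_measure)

lemma AE_cell_measure:
  assumes w: "w \<in> Z"
  shows "AE z in cell_measure \<nu> Q w. Q z = w"
  unfolding cell_measure_def
  using cell_sets[OF w] weights(2) by (intro AE_uniform_measureI AE_I2) (auto simp: cell_def)

text \<open>The transition law of MDP_n before quantization: a state is drawn from the cell of w and
  moves by the original kernel, ending in the original space.\<close>

definition averaged_kernel :: "'z \<Rightarrow> 'a \<Rightarrow> 'z measure" where
  "averaged_kernel w a = cell_measure \<nu> Q w \<bind> (\<lambda>z. trans_kernel M (z, a))"

lemma kernel_section: "(\<lambda>z. trans_kernel M (z, a)) \<in> borel \<rightarrow>\<^sub>M prob_algebra borel"
  by (rule measurable_compose[OF measurable_Pair2' kernel]) simp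

lemma averaged_kernel_measurable:
  assumes "w \<in> Z"
  shows "averaged_kernel w \<in> borel \<rightarrow>\<^sub>M prob_algebra borel"
  unfolding averaged_kernel_def[abs_def]
  using cell_measure_in_prob_algebra[OF assms] measurable_swap_pair[OF kernel]
  by (intro measurable_bind_prob_space2[where N = borel]) auto

text \<open>On the finite set Z it suffices to compare point masses, and the mass of w' under the
  image by Q is that of its cell. In this form the facts on \<open>bind\<close> and
  \<open>distr\<close> supply measurability and integrals.\<close>

lemma trans_kernel_FM:
  assumes w: "w \<in> Z"
  shows "trans_kernel FM (w, a) = distr (averaged_kernel w a) (count_space Z) Q"
proof (rule measure_eqI_finite[where A = Z])
  interpret nu: prob_space "cell_measure \<nu> Q w"
    using cell_measure_in_prob_algebra[OF w] by (simp add: space_prob_algebra)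
  have sets_nu: "sets (cell_measure \<nu> Q w) = sets borel"
    using cell_measure_in_prob_algebra[OF w] by (simp add: space_prob_algebra)
  show "sets (trans_kernel FM (w, a)) = Pow Z"
    by (simp add: finite_model_def sets_point_measure)
  show "sets (distr (averaged_kernel w a) (count_space Z) Q) = Pow Z" "finite Z"
    using finite_Z by simp_all
  fix w' assume w': "w' \<in> Z"
  have sets_avg: "sets (averaged_kernel w a) = sets borel"
    unfolding averaged_kernel_def by (rule sets_bind'[OF cell_measure_in_prob_algebra[OF w] kernel_section])
  have meas: "(\<lambda>z. measure (trans_kernel M (z, a)) (cell Q w')) \<in> borel_measurable (cell_measure \<nu> Q w)"
    using measurable_compose[OF kernel_section measurable_measure_prob_algebra[OF cell_sets[OF w']]]
    by (simp cong: measurable_cong_sets add: sets_nu)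
  have prob: "prob_space (trans_kernel M (z, a))" for z
    by (rule prob_space_kernel) (simp add: space_pair_measure)
  have "emeasure (distr (averaged_kernel w a) (count_space Z) Q) {w'} = emeasure (averaged_kernel w a) (cell Q w')"
    using w' Q_measurable sets_avg
    by (subst emeasure_distr) (auto cong: measurable_cong_sets simp: cell_def vimage_def sets_eq_imp_space_eq[OF sets_avg])
  also have "\<dots> = (\<integral>\<^sup>+z. emeasure (trans_kernel M (z, a)) (cell Q w') \<partial>cell_measure \<nu> Q w)"
    unfolding averaged_kernel_def
    by (rule emeasure_bind_prob_algebra[OF cell_measure_in_prob_algebra[OF w] kernel_section cell_sets[OF w']])
  also have "\<dots> = (\<integral>\<^sup>+z. ennreal (measure (trans_kernel M (z, a)) (cell Q w')) \<partial>cell_measure \<nu> Q w)"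
    by (simp add: finite_measure.emeasure_eq_measure[OF prob_space.finite_measure[OF prob]])
  also have "\<dots> = ennreal (\<integral>z. measure (trans_kernel M (z, a)) (cell Q w') \<partial>cell_measure \<nu> Q w)"
    by (intro nn_integral_eq_integral nu.integrable_bounded[of _ 1] meas)
      (auto simp: prob_space.prob_le_1[OF prob])
  also have "\<dots> = emeasure (trans_kernel FM (w, a)) {w'}"
    using w' finite_Z by (simp add: finite_model_def emeasure_point_measure_finite)
  finally show "emeasure (trans_kernel FM (w, a)) {w'} = emeasure (distr (averaged_kernel w a) (count_space Z) Q) {w'}"
    by simp
qed

lemma is_mdp_FM: "is_mdp FM"
  unfolding is_mdp_def states_FM actions_FM
proof (intro conjI measurable_pair_measure_countable1 countable_finite finite_Z)
  fix w assume w: "w \<in> Z"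
  show "(\<lambda>a. trans_kernel FM (w, a)) \<in> borel \<rightarrow>\<^sub>M prob_algebra (count_space Z)"
    unfolding trans_kernel_FM[OF w]
    by (rule measurable_compose[OF averaged_kernel_measurable[OF w] measurable_distr_prob_space[OF Q_measurable]])
  interpret nu: prob_space "cell_measure \<nu> Q w"
    using cell_measure_in_prob_algebra[OF w] by (simp add: space_prob_algebra)
  have [measurable_cong]: "sets (cell_measure \<nu> Q w) = sets borel"
    using cell_measure_in_prob_algebra[OF w] by (simp add: space_prob_algebra)
  have [measurable]: "(\<lambda>(a, z). stage_cost M (z, a)) \<in> borel_measurable (borel \<Otimes>\<^sub>M cell_measure \<nu> Q w)"
    using measurable_swap_pair[OF cost_measurable] by (simp cong: measurable_cong_sets)
  show "(\<lambda>a. stage_cost FM (w, a)) \<in> borel_measurable borel"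
    unfolding finite_model_def by simp
qed

lemma abs_stage_cost_FM_le:
  assumes w: "w \<in> Z"
  shows "\<bar>stage_cost FM (w, a)\<bar> \<le> K"
proof -
  interpret nu: prob_space "cell_measure \<nu> Q w"
    using cell_measure_in_prob_algebra[OF w] by (simp add: space_prob_algebra)
  have [measurable_cong]: "sets (cell_measure \<nu> Q w) = sets borel"
    using cell_measure_in_prob_algebra[OF w] by (simp add: space_prob_algebra)
  have "(\<lambda>z. stage_cost M (z, a)) \<in> borel_measurable (cell_measure \<nu> Q w)"
    by measurable
  from nu.abs_integral_le_bound[OF this cost_bounded] show ?thesis
    by (simp add: finite_model_def)
qed

section \<open>One-step operators of the two models compared\<close>

definition one_step_FM :: "('z \<Rightarrow> real) \<Rightarrow> 'z \<times> 'a \<Rightarrow> real" where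
  "one_step_FM h x = stage_cost FM x + (\<integral>y. h y \<partial>trans_kernel FM x)"

text \<open>Quantizing the next state amounts to composing h with Q; what remains is an average over
  the cell, in the cost as in the kernel.\<close>

lemma one_step_FM_eq:
  assumes w: "w \<in> Z" and h: "\<And>z. \<bar>h z\<bar> \<le> B"
  shows "one_step_FM h (w, a) = (\<integral>z. one_step (\<lambda>y. h (Q y)) (z, a) \<partial>cell_measure \<nu> Q w)"
proof -
  interpret nu: prob_space "cell_measure \<nu> Q w"
    using cell_measure_in_prob_algebra[OF w] by (simp add: space_prob_algebra)
  have sets_nu[measurable_cong]: "sets (cell_measure \<nu> Q w) = sets borel"
    using cell_measure_in_prob_algebra[OF w] by (simp add: space_prob_algebra)
  have sets_avg[measurable_cong]: "sets (averaged_kernel w a) = sets borel"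
    unfolding averaged_kernel_def by (rule sets_bind'[OF cell_measure_in_prob_algebra[OF w] kernel_section])
  have hQ: "(\<lambda>y. h (Q y)) \<in> borel_measurable borel"
    by (rule measurable_compose[OF Q_measurable]) simp
  have int: "integrable (cell_measure \<nu> Q w) (\<lambda>z. stage_cost M (z, a))"
    by (rule nu.integrable_bounded[of _ K]) (use cost_bounded in auto)
  have "integrable (cell_measure \<nu> Q w) (\<lambda>z. one_step (\<lambda>y. h (Q y)) (z, a))"
  proof (rule nu.integrable_bounded)
    have "(\<lambda>z. \<integral>y. h (Q y) \<partial>trans_kernel M (z, a)) \<in> borel_measurable borel"
      by (rule measurable_compose[OF measurable_prob_algebraD[OF kernel_section]
            integral_measurable_subprob_algebra[OF hQ]])
    then show "(\<lambda>z. one_step (\<lambda>y. h (Q y)) (z, a)) \<in> borel_measurable (cell_measure \<nu> Q w)"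
      unfolding one_step_def by measurable
  qed (rule abs_one_step_le[OF hQ h])
  note int' = this
  have "(\<integral>y. h y \<partial>trans_kernel FM (w, a)) = (\<integral>y. h (Q y) \<partial>averaged_kernel w a)"
    unfolding trans_kernel_FM[OF w]
    by (rule integral_distr) (use Q_measurable in \<open>simp_all cong: measurable_cong_sets add: sets_avg\<close>)
  also have "\<dots> = (\<integral>z. (\<integral>y. h (Q y) \<partial>trans_kernel M (z, a)) \<partial>cell_measure \<nu> Q w)"
    unfolding averaged_kernel_def
    by (rule integral_bind_prob_algebra[OF cell_measure_in_prob_algebra[OF w] kernel_section hQ h])
  also have "\<dots> = (\<integral>z. one_step (\<lambda>y. h (Q y)) (z, a) - stage_cost M (z, a) \<partial>cell_measure \<nu> Q w)"
    by (simp add: one_step_def)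
  also have "\<dots> = (\<integral>z. one_step (\<lambda>y. h (Q y)) (z, a) \<partial>cell_measure \<nu> Q w) - stage_cost FM (w, a)"
    using int int' by (simp add: finite_model_def)
  finally show ?thesis by (simp add: one_step_FM_def)
qed

text \<open>One \<open>e\<close> pays for replacing h \<circ> Q by h under the kernel, the other for
  moving z to the representative of its cell.\<close>

lemma abs_one_step_FM_diff_le:
  assumes w: "w \<in> Z" and h: "h \<in> borel_measurable borel" "\<And>z. \<bar>h z\<bar> \<le> B"
    and osc: "\<And>z. \<bar>h z - h (Q z)\<bar> \<le> e"
    and step: "\<And>z. \<bar>one_step h (z, a) - one_step h (Q z, a)\<bar> \<le> e"
  shows "\<bar>one_step_FM h (w, a) - one_step h (w, a)\<bar> \<le> 2 * e"
proof -
  interpret nu: prob_space "cell_measure \<nu> Q w"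
    using cell_measure_in_prob_algebra[OF w] by (simp add: space_prob_algebra)
  have sets_nu[measurable_cong]: "sets (cell_measure \<nu> Q w) = sets borel"
    using cell_measure_in_prob_algebra[OF w] by (simp add: space_prob_algebra)
  have hQ: "(\<lambda>y. h (Q y)) \<in> borel_measurable borel"
    by (rule measurable_compose[OF Q_measurable]) simp
  have "\<bar>one_step (\<lambda>y. h (Q y)) (z, a) - one_step h (w, a)\<bar> \<le> 2 * e" if z: "Q z = w" for z
  proof -
    have x: "(z, a) \<in> space (borel \<Otimes>\<^sub>M borel)" by (simp add: space_pair_measure)
    interpret k: prob_space "trans_kernel M (z, a)" by (rule prob_space_kernel[OF x])
    note sets = sets_kernel[OF x]
    have "integrable (trans_kernel M (z, a)) h" "integrable (trans_kernel M (z, a)) (\<lambda>y. h (Q y))"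
      using h hQ sets by (auto intro!: k.integrable_bounded[of _ B] cong: measurable_cong_sets)
    then have "one_step h (z, a) - one_step (\<lambda>y. h (Q y)) (z, a) = (\<integral>y. h y - h (Q y) \<partial>trans_kernel M (z, a))"
      by (simp add: one_step_def)
    also have "\<bar>\<dots>\<bar> \<le> e"
      using h hQ sets osc by (intro k.abs_integral_le_bound) (auto cong: measurable_cong_sets)
    finally show ?thesis using step[of z] unfolding z by linarith
  qed
  \<comment> \<open>\<open>cell_measure\<close> is a measure on the whole space that is concentrated
    on the cell, so the bound holds almost everywhere only.\<close>
  then have "AE z in cell_measure \<nu> Q w. \<bar>one_step (\<lambda>y. h (Q y)) (z, a) - one_step h (w, a)\<bar> \<le> 2 * e"
    using AE_cell_measure[OF w] by (auto elim: eventually_mono)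
  then have lower: "AE z in cell_measure \<nu> Q w. one_step h (w, a) - 2 * e \<le> one_step (\<lambda>y. h (Q y)) (z, a)"
    and upper: "AE z in cell_measure \<nu> Q w. one_step (\<lambda>y. h (Q y)) (z, a) \<le> one_step h (w, a) + 2 * e"
    by (auto elim!: eventually_mono)
  have "integrable (cell_measure \<nu> Q w) (\<lambda>z. one_step (\<lambda>y. h (Q y)) (z, a))"
  proof (rule nu.integrable_bounded)
    have "(\<lambda>z. \<integral>y. h (Q y) \<partial>trans_kernel M (z, a)) \<in> borel_measurable borel"
      by (rule measurable_compose[OF measurable_prob_algebraD[OF kernel_section]
            integral_measurable_subprob_algebra[OF hQ]])
    then show "(\<lambda>z. one_step (\<lambda>y. h (Q y)) (z, a)) \<in> borel_measurable (cell_measure \<nu> Q w)"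
      unfolding one_step_def by measurable
  qed (rule abs_one_step_le[OF hQ h(2)])
  from nu.integral_ge_const[OF this lower] nu.integral_le_const[OF this upper]
  show ?thesis
    unfolding one_step_FM_eq[OF w h(2)] by linarith
qed

section \<open>Values and costs compared through approximate equations\<close>

text \<open>For a fine quantizer the optimality equation of the original model and the Poisson equation
  of \<open>f \<circ> Q\<close> both hold up to an error in the finite model; the former controls the value of the
  finite model, the latter the cost of \<open>f\<close> there.\<close>

context
  fixes h :: "'z \<Rightarrow> real" and B r e :: real
  assumes h[measurable]: "h \<in> borel_measurable borel" and h_le: "\<And>z. \<bar>h z\<bar> \<le> B"
    and optimality: "\<And>z. r + h z = (INF a. one_step h (z, a))"
    and B: "K / (1 - lam) \<le> B" and e: "0 < e"
    and fine: "\<And>g z a. g \<in> borel_measurable borel \<Longrightarrow> (\<And>z. \<bar>g z\<bar> \<le> B) \<Longrightarrow>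
      \<bar>one_step g (z, a) - one_step g (Q z, a)\<bar> \<le> e"
begin

text \<open>By the optimality equation h is an infimum of \<open>one_step h\<close> up to a
  constant, so it inherits the modulus of that operator.\<close>

lemma osc_h: "\<bar>h z - h (Q z)\<bar> \<le> e"
  using abs_INF_diff_le[of "\<lambda>a. one_step h (z, a)" "K + B" "\<lambda>a. one_step h (Q z, a)" "K + B" e]
    abs_one_step_le[OF h h_le] fine[OF h h_le, of z] optimality[of z, symmetric] optimality[of "Q z", symmetric]
  by simp

lemma one_step_h_ge: "r \<le> one_step h (z, a) - h z"
proof -
  have "bdd_below (range (\<lambda>a. one_step h (z, a)))"
    using abs_one_step_le[OF h h_le] by (intro bdd_belowI2[of _ "- (K + B)"]) (simp add: abs_le_iff minus_le_iff)
  then have "(INF a. one_step h (z, a)) \<le> one_step h (z, a)"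
    by (rule cINF_lower) simp
  then show ?thesis using optimality[of z] by linarith
qed

lemma near_optimal_action: "\<exists>a. one_step h (z, a) - h z \<le> r + e"
proof -
  obtain a where "one_step h (z, a) < (INF a. one_step h (z, a)) + e"
    using cInf_lessD[of "range (\<lambda>a. one_step h (z, a))" "(INF a. one_step h (z, a)) + e"] e by auto
  then show ?thesis using optimality[of z] by (intro exI[of _ a]) linarith
qed

text \<open>Near-optimal actions are chosen at will for each state; s \<circ> Q is measurable since
  only its values at the finitely many grid points matter. The three errors are near-optimality of
  the action, its transfer from Q x to x, and the oscillation of h on the cell.\<close>

lemma average_value_le: "average_value M z \<le> ereal (r + 3 * e)"
proof -
  obtain s where s: "\<And>z. one_step h (z, s z) - h z \<le> r + e"
    using near_optimal_action by metis
  have sQ: "(\<lambda>z. s (Q z)) \<in> borel \<rightarrow>\<^sub>M borel"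
    by (rule measurable_compose[OF Q_measurable]) simp
  have le: "one_step h (x, s (Q x)) - h x \<le> r + 3 * e" for x
    using s[of "Q x"] fine[OF h h_le, of x "s (Q x)"] osc_h[of x] by linarith
  have "average_cost M (stationary_policy M (\<lambda>z. s (Q z))) z \<le> ereal (r + 3 * e)"
    using le by (intro average_cost_stationary_le[OF is_mdp, where g = h and B = B and K = K])
      (use sQ h h_le cost_bounded in \<open>simp_all add: states actions one_step_def\<close>)
  moreover have "stationary_policy M (\<lambda>z. s (Q z)) \<in> policies M"
    using sQ by (intro stationary_policy_in_policies) (simp add: states actions)
  ultimately show ?thesis
    unfolding average_value_def by (rule INF_lower2[rotated])
qed

lemma average_value_ge: "ereal r \<le> average_value M z"
  unfolding average_value_def
  using one_step_h_ge
  by (intro INF_greatest average_cost_policy_ge[OF is_mdp, where g = h and B = B and K = K])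
    (use h h_le cost_bounded in \<open>simp_all add: states actions one_step_def\<close>)

lemma one_step_FM_h: "w \<in> Z \<Longrightarrow> \<bar>one_step_FM h (w, a) - one_step h (w, a)\<bar> \<le> 2 * e"
  by (rule abs_one_step_FM_diff_le[OF _ h h_le osc_h fine[OF h h_le]])

lemma average_value_FM_ge:
  assumes "w \<in> Z"
  shows "ereal (r - 2 * e) \<le> average_value FM w"
proof -
  have ge: "r - 2 * e \<le> one_step_FM h (x, a) - h x" if "x \<in> Z" for x a
    using one_step_FM_h[OF that, of a] one_step_h_ge[of x a] by linarith
  show ?thesis
    unfolding average_value_def using assms ge
    by (intro INF_greatest average_cost_policy_ge[OF is_mdp_FM, where g = h and B = B and K = K])
      (use h_le abs_stage_cost_FM_le in
        \<open>auto simp: states_FM actions_FM one_step_FM_def space_pair_measure\<close>)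
qed

text \<open>Near-optimal actions cost e, passing to the averaged model 2 e. On the discrete space Z
  every selection is measurable.\<close>

lemma average_value_FM_le:
  assumes "w \<in> Z"
  shows "average_value FM w \<le> ereal (r + 3 * e)"
proof -
  obtain s where s: "\<And>z. one_step h (z, s z) - h z \<le> r + e"
    using near_optimal_action by metis
  have le: "one_step_FM h (x, s x) - h x \<le> r + 3 * e" if "x \<in> Z" for x
    using one_step_FM_h[OF that, of "s x"] s[of x] by linarith
  have "average_cost FM (stationary_policy FM s) w \<le> ereal (r + 3 * e)"
    using assms le by (intro average_cost_stationary_le[OF is_mdp_FM, where g = h and B = B and K = K])
      (use h_le abs_stage_cost_FM_le in
        \<open>auto simp: states_FM actions_FM one_step_FM_def space_pair_measure\<close>)
  moreover have "stationary_policy FM s \<in> policies FM"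
    by (intro stationary_policy_in_policies) (simp add: states_FM actions_FM)
  ultimately show ?thesis
    unfolding average_value_def by (rule INF_lower2[rotated])
qed

text \<open>On a cell f \<circ> Q takes a single action, so by its Poisson equation g varies there
  no more than \<open>one_step g\<close> with that action fixed. Hence g solves the Poisson equation
  of f in the finite model up to 2 e, since Q is the identity on Z.\<close>

lemma average_cost_FM_close:
  assumes w: "w \<in> Z"
  shows "ereal (stationary_cost M (f \<circ> Q) - 2 * e) \<le> average_cost FM (stationary_policy FM f) w"
    and "average_cost FM (stationary_policy FM f) w \<le> ereal (stationary_cost M (f \<circ> Q) + 2 * e)"
proof -
  have fQ: "f \<circ> Q \<in> borel \<rightarrow>\<^sub>M borel"
    unfolding comp_def by (rule measurable_compose[OF Q_measurable]) simp
  obtain g where g: "g \<in> borel_measurable borel" "\<And>z. \<bar>g z\<bar> \<le> K / (1 - lam)"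
    "\<And>z. stationary_cost M (f \<circ> Q) + g z = one_step g (z, (f \<circ> Q) z)"
    using stationary_poisson[OF fQ] by metis
  have g_le: "\<bar>g z\<bar> \<le> B" for z
    using g(2)[of z] B by linarith
  have "\<bar>g z - g (Q z)\<bar> \<le> e" for z
    using g(3)[of z] g(3)[of "Q z"] fine[OF g(1) g_le, of z "f (Q z)"] by (simp add: Q_id[OF Q_in])
  then have g_FM: "\<bar>one_step_FM g (x, a) - one_step g (x, a)\<bar> \<le> 2 * e" if "x \<in> Z" for x a
    using abs_one_step_FM_diff_le[OF that g(1) g_le _ fine[OF g(1) g_le]] by blast
  have lower: "stationary_cost M (f \<circ> Q) - 2 * e \<le> one_step_FM g (x, f x) - g x"
    and upper: "one_step_FM g (x, f x) - g x \<le> stationary_cost M (f \<circ> Q) + 2 * e" if "x \<in> Z" for x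
    using g_FM[OF that, of "f x"] g(3)[of x] unfolding comp_apply Q_id[OF that] by linarith+
  show "ereal (stationary_cost M (f \<circ> Q) - 2 * e) \<le> average_cost FM (stationary_policy FM f) w"
    using lower w
    by (intro average_cost_stationary_ge[OF is_mdp_FM, where g = g and B = B and K = K])
      (use g_le abs_stage_cost_FM_le in
        \<open>auto simp: states_FM actions_FM one_step_FM_def space_pair_measure\<close>)
  show "average_cost FM (stationary_policy FM f) w \<le> ereal (stationary_cost M (f \<circ> Q) + 2 * e)"
    using upper w
    by (intro average_cost_stationary_le[OF is_mdp_FM, where g = g and B = B and K = K])
      (use g_le abs_stage_cost_FM_le in
        \<open>auto simp: states_FM actions_FM one_step_FM_def space_pair_measure\<close>)
qed

text \<open>At any grid point the cost of f is the value of the finite model. Chaining the bounds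
  gives an error 2 e + 3 e from above and 2 e + 2 e from below.\<close>

lemma stationary_cost_optimal_FM:
  assumes "optimal_stationary FM f"
  shows "\<bar>stationary_cost M (f \<circ> Q) - r\<bar> \<le> 5 * e"
proof -
  obtain w where w: "w \<in> Z" using Z_nonempty by blast
  have eq: "average_cost FM (stationary_policy FM f) w = average_value FM w"
    using assms w by (auto simp: optimal_stationary_def states_FM)
  have "ereal (stationary_cost M (f \<circ> Q) - 2 * e) \<le> ereal (r + 3 * e)"
    using average_cost_FM_close(1)[OF w, of f] average_value_FM_le[OF w] unfolding eq by (rule order_trans)
  moreover have "ereal (r - 2 * e) \<le> ereal (stationary_cost M (f \<circ> Q) + 2 * e)"
    using average_value_FM_ge[OF w] average_cost_FM_close(2)[OF w, of f] unfolding eq by (rule order_trans)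
  ultimately show ?thesis using e by (simp add: abs_le_iff)
qed

end

end

section \<open>Convergence\<close>

text \<open>Heine-Cantor by a Lebesgue number: points closer than \<delta> share a ball around some
  x0, and each lies within e / 2 of p x0 on all sets. The conclusion is phrased on sets to feed
  \<open>abs_integral_diff_le\<close>.\<close>

lemma uniform_tv_modulus:
  fixes p :: "'x::metric_space \<Rightarrow> 's measure"
  assumes compact: "compact (UNIV :: 'x set)"
    and p: "\<And>x. p x \<in> space (prob_algebra N)"
    and cont: "\<And>x. ((\<lambda>y. tv_dist (p y) (p x)) \<longlongrightarrow> 0) (at x)" and e: "0 < e"
  obtains d where "0 < d"
    "\<And>x y D. dist x y < d \<Longrightarrow> D \<in> sets N \<Longrightarrow> \<bar>measure (p x) D - measure (p y) D\<bar> \<le> e"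
proof -
  have local: "\<exists>d>0. \<forall>y D. dist y x < d \<longrightarrow> D \<in> sets N \<longrightarrow> \<bar>measure (p y) D - measure (p x) D\<bar> \<le> e / 2" for x
  proof -
    \<comment> \<open>The factor 2 in \<open>tv_dist\<close> turns the bound e into e / 2 on
      sets.\<close>
    have "\<forall>\<^sub>F y in at x. tv_dist (p y) (p x) < e"
      using cont e by (rule order_tendstoD)
    then obtain d where d: "0 < d" "\<And>y. y \<noteq> x \<Longrightarrow> dist y x < d \<Longrightarrow> tv_dist (p y) (p x) < e"
      by (auto simp: eventually_at)
    have "\<bar>measure (p y) D - measure (p x) D\<bar> \<le> e / 2" if "dist y x < d" "D \<in> sets N" for y D
    proof (cases "y = x")
      case False
      then show ?thesis
        using d(2)[of y] that abs_measure_diff_le_tv_dist[of "p y" "p x" D] p by (simp add: space_prob_algebra)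
    qed (use e in simp)
    with d(1) show ?thesis by blast
  qed
  then obtain d where d: "\<And>x. 0 < d x"
    "\<And>x y D. dist y x < d x \<Longrightarrow> D \<in> sets N \<Longrightarrow> \<bar>measure (p y) D - measure (p x) D\<bar> \<le> e / 2"
    by metis
  have "UNIV \<subseteq> \<Union>(range (\<lambda>x. ball x (d x)))"
    using d(1) by auto
  from Heine_Borel_lemma[OF compact this] obtain \<delta> where \<delta>: "0 < \<delta>" "\<And>x. \<exists>x0. ball x \<delta> \<subseteq> ball x0 (d x0)"
    by auto
  have "\<bar>measure (p x) D - measure (p y) D\<bar> \<le> e" if "dist x y < \<delta>" "D \<in> sets N" for x y D
  proof -
    obtain x0 where "ball x \<delta> \<subseteq> ball x0 (d x0)" using \<delta>(2) by blast
    moreover have "x \<in> ball x \<delta>" "y \<in> ball x \<delta>" using that \<delta>(1) by auto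
    ultimately have "x \<in> ball x0 (d x0)" "y \<in> ball x0 (d x0)" by blast+
    then have "dist x x0 < d x0" "dist y x0 < d x0" by (simp_all add: dist_commute)
    then show ?thesis
      using d(2)[of x x0 D] d(2)[of y x0 D] that(2) by linarith
  qed
  with \<delta>(1) that show ?thesis by blast
qed

theorem theorem2p6:
  fixes M :: "('z::polish_space, 'a::polish_space) mdp"
    and \<zeta> :: "'z measure" and \<theta> :: "'z \<times> 'a \<Rightarrow> real" and lam :: real
    and Z :: "nat \<Rightarrow> 'z set" and Q :: "nat \<Rightarrow> 'z \<Rightarrow> 'z" and \<nu> :: "nat \<Rightarrow> 'z measure"
    and f :: "nat \<Rightarrow> 'z \<Rightarrow> 'a"
  assumes "states M = borel" and "actions M = borel" and "is_mdp M"
    and "compact (UNIV :: 'z set)" and "compact (UNIV :: 'a set)"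
    and "bounded (range (stage_cost M))" and "continuous_on UNIV (stage_cost M)"
    and "\<And>x. ((\<lambda>y. tv_dist (trans_kernel M y) (trans_kernel M x)) \<longlongrightarrow> 0) (at x)"
    and "finite_measure \<zeta>" and "sets \<zeta> = sets borel" and "emeasure \<zeta> UNIV \<noteq> 0"
    and "\<theta> \<in> borel_measurable (borel \<Otimes>\<^sub>M borel)" and "\<And>x. 0 \<le> \<theta> x"
    and "0 < lam" and "lam < 1"
    and "\<And>x B. B \<in> sets borel \<Longrightarrow> measure (trans_kernel M x) B \<ge> measure \<zeta> B * \<theta> x"
    and "\<And>x. (1 - lam) / measure \<zeta> UNIV \<le> \<theta> x"
    and "\<And>n. n \<ge> 1 \<Longrightarrow> nearest_quantizer n (Z n) (Q n)"
    and "\<And>n. n \<ge> 1 \<Longrightarrow> prob_space (\<nu> n) \<and> sets (\<nu> n) = sets borel"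
    and "\<And>n w. n \<ge> 1 \<Longrightarrow> w \<in> Z n \<Longrightarrow> measure (\<nu> n) (cell (Q n) w) > 0"
    and "\<And>n. n \<ge> 1 \<Longrightarrow> optimal_stationary (finite_model M (Z n) (Q n) (\<nu> n)) (f n)"
  shows "\<exists>\<rho>. (\<forall>z. average_value M z = ereal \<rho>) \<and>
             (\<forall>fs. optimal_stationary M fs \<longrightarrow> stationary_cost M fs = \<rho>) \<and>
             (\<lambda>n. \<bar>stationary_cost M (f n \<circ> Q n) - \<rho>\<bar>) \<longlonglongrightarrow> 0"
proof -
  note mdp = assms(3) and cont = assms(7) and tv = assms(8)
  have kernel: "trans_kernel M \<in> borel \<Otimes>\<^sub>M borel \<rightarrow>\<^sub>M prob_algebra borel"
    and cost: "stage_cost M \<in> borel_measurable (borel \<Otimes>\<^sub>M borel)"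
    using mdp by (auto simp: is_mdp_def assms(1,2))
  have trans: "trans_kernel M x \<in> space (prob_algebra borel)" for x
    by (rule measurable_space[OF kernel]) (simp add: space_pair_measure)
  obtain K where K: "\<And>x. \<bar>stage_cost M x\<bar> \<le> K"
    using assms(6) by (auto simp: bounded_iff)
  interpret zeta: finite_measure \<zeta> by (rule assms(9))
  have space_zeta: "space \<zeta> = UNIV"
    using sets_eq_imp_space_eq[OF assms(10)] by simp
  have zeta_pos: "0 < measure \<zeta> UNIV"
    using assms(11) by (simp add: zeta.emeasure_eq_measure zero_less_measure_iff)
  \<comment> \<open>After normalisation, the lower bound (1 - lam) / \<zeta>(Z) on \<theta> becomes
    the weight 1 - lam of the minorant.\<close>
  define \<zeta>' where "\<zeta>' = uniform_measure \<zeta> UNIV"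
  have \<zeta>': "\<zeta>' \<in> space (prob_algebra borel)"
    using assms(10,11) by (auto simp: \<zeta>'_def space_prob_algebra intro!: prob_space_uniform_measure)
  have minor: "(1 - lam) * measure \<zeta>' B \<le> measure (trans_kernel M x) B" if B: "B \<in> sets borel" for x B
  proof -
    have "(1 - lam) * measure \<zeta>' B = measure \<zeta> B * ((1 - lam) / measure \<zeta> UNIV)"
      using B assms(10,11) by (simp add: \<zeta>'_def measure_uniform_measure)
    also have "\<dots> \<le> measure \<zeta> B * \<theta> x"
      by (intro mult_left_mono assms(17)) simp
    also have "\<dots> \<le> measure (trans_kernel M x) B"
      by (rule assms(16)[OF B])
    finally show ?thesis .
  qed
  have compact: "compact (UNIV :: ('z \<times> 'a) set)"
    using compact_Times[OF assms(4,5)] by simp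
  have doeblin: "doeblin_mdp M \<zeta>' lam K"
    by (unfold_locales; (rule kernel \<zeta>' assms(1,2,14,15) cost K | (rule minor, assumption)))
  interpret equicontinuous_mdp M \<zeta>' lam K
  proof (rule equicontinuous_mdp.intro[OF doeblin], rule equicontinuous_mdp_axioms.intro)
    fix B e :: real assume B: "0 < B" and e: "0 < e"
    have "uniformly_continuous_on UNIV (stage_cost M)"
      using cont compact by (rule compact_uniformly_continuous)
    then have "\<exists>d>0. \<forall>x y. dist y x < d \<longrightarrow> dist (stage_cost M y) (stage_cost M x) < e"
      using e by (simp add: uniformly_continuous_on_def)
    then obtain d1 where d1: "0 < d1" "\<And>x y. dist x y < d1 \<Longrightarrow> \<bar>stage_cost M x - stage_cost M y\<bar> < e"
      by (auto simp: dist_real_def)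
    \<comment> \<open>The tolerance e / (2 B) cancels the factor 2 B in
      \<open>abs_integral_diff_le\<close>.\<close>
    obtain d2 where d2: "0 < d2" "\<And>x y D. dist x y < d2 \<Longrightarrow> D \<in> sets borel \<Longrightarrow>
        \<bar>measure (trans_kernel M x) D - measure (trans_kernel M y) D\<bar> \<le> e / (2 * B)"
      using uniform_tv_modulus[OF compact trans tv, of "e / (2 * B)"] B e by auto
    have "\<bar>(\<integral>z. h z \<partial>trans_kernel M x) - (\<integral>z. h z \<partial>trans_kernel M y)\<bar> \<le> e"
      if "dist x y < d2" "h \<in> borel_measurable borel" "\<And>z. \<bar>h z\<bar> \<le> B" for h x y
    proof -
      have "\<bar>(\<integral>z. h z \<partial>trans_kernel M x) - (\<integral>z. h z \<partial>trans_kernel M y)\<bar> \<le> 2 * B * (e / (2 * B))"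
        using trans[of x] trans[of y] that d2(2)[OF that(1)] B
        by (intro abs_integral_diff_le) (auto simp: space_prob_algebra cong: measurable_cong_sets)
      then show ?thesis using B by simp
    qed
    then show "\<exists>d>0. \<forall>x y. dist x y < d \<longrightarrow> \<bar>stage_cost M x - stage_cost M y\<bar> \<le> e \<and>
      (\<forall>h\<in>borel_measurable borel. (\<forall>z. \<bar>h z\<bar> \<le> B) \<longrightarrow>
         \<bar>(\<integral>z. h z \<partial>trans_kernel M x) - (\<integral>z. h z \<partial>trans_kernel M y)\<bar> \<le> e)"
      using d1 d2(1) by (intro exI[of _ "min d1 d2"]) (simp add: less_imp_le)
  qed
  obtain h B0 r where h: "h \<in> borel_measurable borel" "0 < B0" "\<And>z. \<bar>h z\<bar> \<le> B0"
    "\<And>z. r + h z = (INF a. one_step h (z, a))"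
    using optimality_equation by metis
  \<comment> \<open>One bound for h and for the Poisson solutions of all policies
    \<open>f n \<circ> Q n\<close>, so that the scale d obtained from it is independent of
    n.\<close>
  define B where "B = max B0 (K / (1 - lam))"
  have B: "0 < B" "K / (1 - lam) \<le> B" "\<And>z. \<bar>h z\<bar> \<le> B"
    using h(2,3) by (auto simp: B_def le_max_iff_disj less_max_iff_disj)
  have close: "\<forall>\<^sub>F n in sequentially. \<bar>stationary_cost M (f n \<circ> Q n) - r\<bar> \<le> 5 * e \<and>
      (\<forall>z. ereal r \<le> average_value M z \<and> average_value M z \<le> ereal (r + 3 * e))" if e: "0 < e" for e
  proof -
    obtain d where d: "0 < d" "\<And>g x y. g \<in> borel_measurable borel \<Longrightarrow> (\<And>z. \<bar>g z\<bar> \<le> B) \<Longrightarrow>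
        dist x y < d \<Longrightarrow> \<bar>one_step g x - one_step g y\<bar> \<le> e"
      using one_step_modulus[OF B(1) e] by metis
    have "\<forall>\<^sub>F n in sequentially. 1 / real n < d"
      using lim_1_over_n d(1) by (rule order_tendstoD)
    then show ?thesis
      using eventually_ge_at_top[of 1]
    proof eventually_elim
      case (elim n)
      interpret quantized_mdp M \<zeta>' lam K n "Z n" "Q n" "\<nu> n"
        using assms(18-20)[of n] elim(2)
        by (intro quantized_mdp.intro[OF doeblin] quantized_mdp_axioms.intro) simp_all
      have fine: "\<bar>one_step g (z, a) - one_step g (Q n z, a)\<bar> \<le> e"
        if "g \<in> borel_measurable borel" "\<And>z. \<bar>g z\<bar> \<le> B" for g z a
        using dist_Q[of z] elim by (intro d(2) that) (simp add: dist_Pair_Pair)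
      show ?case
        by (intro conjI allI stationary_cost_optimal_FM[OF h(1) B(3) h(4) B(2) e fine] assms(21) elim(2)
            average_value_ge[OF h(1) B(3) h(4) B(2) e fine] average_value_le[OF h(1) B(3) h(4) B(2) e fine])
    qed
  qed
  \<comment> \<open>The upper bound on the original value was itself witnessed by a policy built
    from a quantizer, so it is taken from a sufficiently large n for each e.\<close>
  have constant_value: "average_value M z = ereal r" for z
  proof (rule antisym)
    have bounds: "ereal r \<le> average_value M z \<and> average_value M z \<le> ereal (r + 3 * e)" if "0 < e" for e
      using eventually_happens[OF close[OF that]] by auto
    show "ereal r \<le> average_value M z" by (rule bounds[OF zero_less_one, THEN conjunct1])
    show "average_value M z \<le> ereal r"
    proof (rule ereal_le_epsilon2)
      fix e :: real assume "0 < e"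
      then show "average_value M z \<le> ereal r + ereal e"
        using bounds[of "e / 3"] by simp
    qed
  qed
  have "(\<lambda>n. \<bar>stationary_cost M (f n \<circ> Q n) - r\<bar>) \<longlonglongrightarrow> 0"
  proof (rule tendstoI)
    fix e :: real assume "0 < e"
    then show "\<forall>\<^sub>F n in sequentially. dist \<bar>stationary_cost M (f n \<circ> Q n) - r\<bar> 0 < e"
      \<comment> \<open>Dividing by 6 keeps 5 * (e / 6) strictly below e.\<close>
      using close[of "e / 6"] by (auto elim!: eventually_mono simp: dist_real_def)
  qed
  moreover have "stationary_cost M fs = r" if "optimal_stationary M fs" for fs
  proof -
    have "ereal (stationary_cost M fs) = average_value M z" for z
      using that average_cost_stationary[of fs z] by (simp add: optimal_stationary_def assms(1,2))
    then show ?thesis by (simp add: constant_value)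
  qed
  ultimately show ?thesis using constant_value by blast
qed

end
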